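(* Assume $\diamondsuit$. Then there is an Aronszajn compactum $X$ which is both hereditarily separable and hereditarily Lindelöf.
   Context: All topological spaces are Hausdorff. $w(X)$ is the weight and $\chi(X)$ the character of $X$ (so $\chi(X)=\aleph_0$ means $X$ is first countable). $\diamondsuit$ is Jensen's diamond principle on $\omega_1$. For a closed $X\subseteq[0,1]^{\omega_1}$ and $\alpha<\omega_1$, let $\pi^{\omega_1}_\alpha:[0,1]^{\omega_1}\to[0,1]^{\alpha}$ be the natural projection, $X_\alpha=\pi^{\omega_1}_\alpha(X)$, and $\sigma^{\omega_1}_\alpha=\pi^{\omega_1}_\alpha\restriction X: X\to X_\alpha$. An embedded Aronszajn compactum is a closed $X\subseteq[0,1]^{\omega_1}$ with $w(X)=\aleph_1$ and $\chi(X)=\aleph_0$ such that for some club $C\subseteq\omega_1$, for each $\alpha\in C$ the set $\mathcal{L}_\alpha:=\{x\in X_\alpha:|(\sigma^{\omega_1}_\alpha)^{-1}\{x\}|>1\}$ is countable. An Aronszajn compactum is a compact space $X$ with $w(X)=\aleph_1$ and $\chi(X)=\aleph_0$ such that some (equivalently, every) $Z\subseteq[0,1]^{\omega_1}$ homeomorphic to $X$ is an embedded Aronszajn compactum. *)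

theory Defs
  imports "HOL-Analysis.Analysis"
begin

unbundle cardinal_syntax

section \<open>The ordinal $\omega_1$\<close>

text \<open>
  The relation \<^term>\<open>cardSuc natLeq\<close> is the successor cardinal of $\aleph_0$, represented as an
  initial well-order.  So it serves both as the cardinal $\aleph_1$ and as the order of $\omega_1$.
\<close>

abbreviation aleph1 :: "nat set rel"
  where "aleph1 \<equiv> cardSuc natLeq"

lemma Card_order_aleph1: "Card_order aleph1"
  using natLeq_Card_order by (rule cardSuc_Card_order)

lemma infinite_Field_aleph1: "infinite (Field aleph1)"
  using natLeq_Card_order Field_natLeq by (simp add: cardSuc_finite)

lemma Well_order_aleph1: "Well_order aleph1"
  using Card_order_aleph1 by (simp add: card_order_on_well_order_on)

typedef omega1 = "Field aleph1"
  using infinite_Field_aleph1 by (metis ex_in_conv finite.emptyI)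

instantiation omega1 :: wellorder
begin

definition less_eq_omega1 :: "omega1 \<Rightarrow> omega1 \<Rightarrow> bool"
  where "\<alpha> \<le> \<beta> \<longleftrightarrow> (Rep_omega1 \<alpha>, Rep_omega1 \<beta>) \<in> aleph1"

definition less_omega1 :: "omega1 \<Rightarrow> omega1 \<Rightarrow> bool"
  where "\<alpha> < \<beta> \<longleftrightarrow> \<alpha> \<le> \<beta> \<and> \<not> \<beta> \<le> (\<alpha>::omega1)"

instance
proof
  interpret wo_rel aleph1
    using Well_order_aleph1 by (simp add: wo_rel_def)
  fix x y z :: omega1
  show "x < y \<longleftrightarrow> x \<le> y \<and> \<not> y \<le> x" by (rule less_omega1_def)
  show "x \<le> x"
    using REFL Rep_omega1[of x] unfolding less_eq_omega1_def refl_on_def by blast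
  show "x \<le> z" if "x \<le> y" "y \<le> z"
    using that TRANS unfolding less_eq_omega1_def trans_def by blast
  show "x = y" if "x \<le> y" "y \<le> x"
    using that ANTISYM Rep_omega1_inject[of x y] unfolding less_eq_omega1_def antisym_def by blast
  show "x \<le> y \<or> y \<le> x"
    using TOTALS Rep_omega1[of x] Rep_omega1[of y] unfolding less_eq_omega1_def by blast
next
  fix P :: "omega1 \<Rightarrow> bool" and a :: omega1
  assume step: "\<And>x. (\<And>y. y < x \<Longrightarrow> P y) \<Longrightarrow> P x"
  interpret wo_rel aleph1
    using Well_order_aleph1 by (simp add: wo_rel_def)
  have "wf (inv_image (aleph1 - Id) Rep_omega1)"
    using WF by (rule wf_inv_image)
  then show "P a"
  proof (induction a rule: wf_induct_rule)
    case (less x)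
    show ?case
    proof (rule step)
      fix y assume "y < x"
      then have "y \<le> x" "y \<noteq> x"
        unfolding less_omega1_def by auto
      then show "P y"
        by (intro less) (auto simp: less_eq_omega1_def Rep_omega1_inject)
    qed
  qed
qed

end

lemma card_of_omega1: "|UNIV :: omega1 set| =o aleph1"
proof -
  have "bij_betw Rep_omega1 UNIV (Field aleph1)"
    unfolding bij_betw_def using type_definition.Rep_range[OF type_definition_omega1]
    by (simp add: inj_on_def Rep_omega1_inject)
  then have "|UNIV :: omega1 set| =o |Field aleph1|"
    using card_of_ordIso by blast
  then show ?thesis
    using card_of_Field_ordIso[OF Card_order_aleph1] ordIso_transitive by blast
qed

lemma countable_lessThan_omega1: "countable {..<\<alpha>::omega1}"
proof -
  have "bij_betw Rep_omega1 {..<\<alpha>} (Rep_omega1 ` {..<\<alpha>})"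
    by (simp add: inj_on_def Rep_omega1_inject bij_betw_def)
  moreover have "Rep_omega1 ` {..<\<alpha>} \<subseteq> underS aleph1 (Rep_omega1 \<alpha>)"
    by (auto simp: underS_def less_omega1_def less_eq_omega1_def Rep_omega1_inject)
  ultimately have "|{..<\<alpha>}| \<le>o |underS aleph1 (Rep_omega1 \<alpha>)|"
    using card_of_ordLeq by (metis bij_betw_def)
  also have "|underS aleph1 (Rep_omega1 \<alpha>)| <o aleph1"
    using Card_order_aleph1 Rep_omega1 by (rule card_of_underS)
  finally have "|{..<\<alpha>}| \<le>o natLeq"
    using cardSuc_ordLeq_ordLess[OF natLeq_Card_order card_of_Card_order] by blast
  then have "|{..<\<alpha>}| \<le>o |UNIV :: nat set|"
    using card_of_nat ordIso_symmetric ordLeq_ordIso_trans by blast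
  then show ?thesis
    unfolding countable_def using card_of_ordLeq[of "{..<\<alpha>}" "UNIV :: nat set"] by auto
qed


section \<open>Clubs, stationary sets and the diamond principle\<close>

text \<open>
  In the closedness clause the first premise excludes \<open>\<alpha> = 0\<close>, and the second one fails for
  successors, so \<open>\<alpha>\<close> is a limit ordinal in which \<open>C\<close> is unbounded.
\<close>

definition club :: "omega1 set \<Rightarrow> bool"
  where "club C \<longleftrightarrow>
    (\<forall>\<alpha>. \<exists>\<gamma>\<in>C. \<alpha> < \<gamma>) \<and>
    (\<forall>\<alpha>. (\<exists>\<beta>. \<beta> < \<alpha>) \<and> (\<forall>\<beta><\<alpha>. \<exists>\<gamma>\<in>C. \<beta> < \<gamma> \<and> \<gamma> < \<alpha>) \<longrightarrow> \<alpha> \<in> C)"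

definition stationary :: "omega1 set \<Rightarrow> bool"
  where "stationary S \<longleftrightarrow> (\<forall>C. club C \<longrightarrow> S \<inter> C \<noteq> {})"

definition diamond :: bool
  where "diamond \<longleftrightarrow>
    (\<exists>A :: omega1 \<Rightarrow> omega1 set. (\<forall>\<alpha>. A \<alpha> \<subseteq> {..<\<alpha>}) \<and>
      (\<forall>B. stationary {\<alpha>. B \<inter> {..<\<alpha>} = A \<alpha>}))"


section \<open>Aronszajn compacta\<close>

definition is_base :: "'a topology \<Rightarrow> 'a set set \<Rightarrow> bool"
  where "is_base X \<B> \<longleftrightarrow>
    (\<forall>V\<in>\<B>. openin X V) \<and>
    (\<forall>U x. openin X U \<and> x \<in> U \<longrightarrow> (\<exists>V\<in>\<B>. x \<in> V \<and> V \<subseteq> U))"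

text \<open>\<open>has_weight X \<kappa>\<close> says that \<open>\<kappa>\<close> is the least cardinality of a base of \<open>X\<close>.\<close>

definition has_weight :: "'a topology \<Rightarrow> 'k rel \<Rightarrow> bool"
  where "has_weight X \<kappa> \<longleftrightarrow>
    (\<exists>\<B>. is_base X \<B> \<and> |\<B>| =o \<kappa>) \<and> (\<forall>\<B>. is_base X \<B> \<longrightarrow> \<kappa> \<le>o |\<B>| )"

definition cube :: "(omega1 \<Rightarrow> real) topology"
  where "cube = product_topology (\<lambda>_. top_of_set {0..1}) UNIV"

text \<open>The projection to $[0,1]^\alpha$, where $\alpha$ is the set of smaller ordinals.\<close>

definition proj :: "omega1 \<Rightarrow> (omega1 \<Rightarrow> real) \<Rightarrow> (omega1 \<Rightarrow> real)"
  where "proj \<alpha> x = restrict x {..<\<alpha>}"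

definition nontrivial_fibres :: "(omega1 \<Rightarrow> real) set \<Rightarrow> omega1 \<Rightarrow> (omega1 \<Rightarrow> real) set"
  where "nontrivial_fibres Z \<alpha> =
    {x \<in> proj \<alpha> ` Z. \<exists>y\<in>Z. \<exists>z\<in>Z. y \<noteq> z \<and> proj \<alpha> y = x \<and> proj \<alpha> z = x}"

definition embedded_Aronszajn_compactum :: "(omega1 \<Rightarrow> real) set \<Rightarrow> bool"
  where "embedded_Aronszajn_compactum Z \<longleftrightarrow>
    closedin cube Z \<and>
    has_weight (subtopology cube Z) aleph1 \<and>
    first_countable (subtopology cube Z) \<and>
    (\<exists>C. club C \<and> (\<forall>\<alpha>\<in>C. countable (nontrivial_fibres Z \<alpha>)))"

definition Aronszajn_compactum :: "'a topology \<Rightarrow> bool"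
  where "Aronszajn_compactum X \<longleftrightarrow>
    compact_space X \<and> Hausdorff_space X \<and>
    has_weight X aleph1 \<and> first_countable X \<and>
    (\<exists>Z. Z \<subseteq> topspace cube \<and> X homeomorphic_space subtopology cube Z \<and>
      embedded_Aronszajn_compactum Z)"

end

theory Submission
  imports Defs
begin

text \<open>
  The space is an inverse limit of compact metrizable spaces $X_\alpha \subseteq [0,1]^\alpha$.  At
  each stage the points of a countable set $L_\alpha \subseteq X_\alpha$ are replaced by intervals
  while all other points have a unique extension, so the fibres over $X_\alpha$ are trivial outside
  $L_\alpha$.  Diamond guesses closed sets $F_\alpha \subseteq X_\alpha$, and from stage $\alpha$ on
  all bonding maps are kept irreducible over $F_\alpha$; this is possible because the points of
  $L_\alpha$ are chosen not to be isolated in $F_\alpha$, only countably many points being excluded.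
  If $F_\alpha$ is the projection of a closed set $H$ of the limit, irreducibility forces $H$ to be
  the full preimage of $F_\alpha$.  So every closed set is determined by countably many
  coordinates, which gives first countability and the hereditary Lindelof property, while
  irreducibility gives countable dense subsets.
\<close>

section \<open>Splitting points irreducibly\<close>

text \<open>Splitting and irreducibility pull in opposite directions. If \<open>x\<close> is
  isolated in a guessed set and becomes an interval, a small open part of that interval contains no
  full fibre over the guess. If \<open>x\<close> is a limit of the guess, the new coordinate can
  oscillate near \<open>x\<close> like sin(1/r), so that its graph over the guess accumulates at the
  whole interval and full fibres enter every open part of it. One oscillation serves the countably
  many guesses made so far, and irreducibility itself passes non-isolation on to the preimages of
  old guesses. Irreducibility also explains why one correct guess suffices: if \<open>x\<close> lay
  over the projection of a closed set \<open>H\<close> but outside \<open>H\<close>, some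
  neighbourhood of \<open>x\<close> missing \<open>H\<close> would contain the full preimage of a
  piece of that projection, yet \<open>H\<close> meets this preimage. Diamond guesses sets of
  ordinals, so a closed set is coded by names of rational boxes missing it. At club many \<alpha>
  all boxes on coordinates below \<alpha> have names below \<alpha>, and there the guessed code
  describes the projection exactly.\<close>

lemma compact_imp_closed_Hausdorff:
  fixes S :: "'a::topological_space set"
  assumes "Hausdorff_space (euclidean :: 'a topology)" "compact S"
  shows "closed S"
  using compactin_imp_closedin[OF assms(1)] assms(2) by simp

lemma Hausdorff_space_euclidean_t2: "Hausdorff_space (euclidean :: 'a::t2_space topology)"
  unfolding Hausdorff_space_def disjnt_def using hausdorff by fastforce

lemma Hausdorff_space_euclidean_prod:
  assumes "Hausdorff_space (euclidean :: 'a::topological_space topology)"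
  shows "Hausdorff_space (euclidean :: ('a \<times> 'b::t2_space) topology)"
proof -
  have "Hausdorff_space (prod_topology (euclidean :: 'a topology) (euclidean :: 'b topology))"
    by (rule Hausdorff_space_prod_topology[THEN iffD2])
      (use assms Hausdorff_space_euclidean_t2 in blast)
  then show ?thesis by simp
qed

lemma Hausdorff_space_euclidean_fun:
  "Hausdorff_space (euclidean :: ('i \<Rightarrow> 'b::t2_space) topology)"
  by (subst euclidean_product_topology[symmetric])
    (simp add: Hausdorff_space_product_topology Hausdorff_space_euclidean_t2)

text \<open>The analogue of sin(1/r) at \<open>x\<close>. Taking \<open>h\<close> to be a function
  of the radius \<open>g\<close> reduces the problem to a continuous real function on (0,
  \<infinity>) with prescribed values at a sequence of radii. The sequence visits all sets in
  \<open>\<F>\<close> and a dense set of target values, so the graph over each set accumulates at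
  every point above \<open>x\<close>.\<close>

lemma ex_oscillating_function:
  fixes x :: "'a::topological_space" and X :: "'a set" and \<F> :: "'a set set"
  assumes "compact X" "x \<in> X"
    and g: "continuous_on X g" "\<And>y. y \<in> X \<Longrightarrow> 0 \<le> g y" "\<And>y. y \<in> X \<Longrightarrow> g y = (0::real) \<longleftrightarrow> y = x"
    and "countable \<F>" and sub: "\<And>F. F \<in> \<F> \<Longrightarrow> F \<subseteq> X" and lim: "\<And>F. F \<in> \<F> \<Longrightarrow> x islimpt F"
  obtains h :: "'a \<Rightarrow> real" where "continuous_on (X - {x}) h" "\<And>y. h y \<in> {0..1}"
    "\<And>F t U. F \<in> \<F> \<Longrightarrow> t \<in> {0..1} \<Longrightarrow> open U \<Longrightarrow> (x, t) \<in> U \<Longrightarrow> \<exists>y\<in>F. y \<noteq> x \<and> (y, h y) \<in> U"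
proof (cases "\<F> = {}")
  case True
  show ?thesis
    by (rule that[of "\<lambda>_. 0"]) (use True in auto)
next
  case False
  \<comment> \<open>By compactness the sublevel sets of \<open>g\<close> form a neighbourhood base
    at \<open>x\<close> in \<open>X\<close>, so closeness to \<open>x\<close> is measured by
    \<open>g\<close> alone.\<close>
  have near: "\<exists>e>0. \<forall>y\<in>X. g y < e \<longrightarrow> y \<in> A" if "open A" "x \<in> A" for A
  proof (cases "X - A = {}")
    case True then show ?thesis by (intro exI[of _ 1]) auto
  next
    case False
    have "compact (X - A)" using \<open>compact X\<close> \<open>open A\<close> by (rule compact_diff)
    moreover have "continuous_on (X - A) g" using g(1) continuous_on_subset by blast
    ultimately obtain z where z: "z \<in> X - A" "\<And>y. y \<in> X - A \<Longrightarrow> g z \<le> g y"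
      using continuous_attains_inf[OF _ False] by metis
    then have "g z > 0" using g(2,3)[of z] that by force
    then show ?thesis using z(2) by (intro exI[of _ "g z"]) force
  qed
  have small: "\<exists>y\<in>F. y \<noteq> x \<and> 0 < g y \<and> g y < e" if F: "F \<in> \<F>" and "e > 0" for F e
  proof -
    obtain A where A: "open A" "A \<inter> X = g -` {..<e} \<inter> X"
      using g(1) unfolding continuous_on_open_invariant by (metis open_lessThan)
    then have "x \<in> A" using g(3)[of x] that \<open>x \<in> X\<close> by auto
    then obtain y where y: "y \<in> F" "y \<in> A" "y \<noteq> x"
      using lim[OF F] A(1) unfolding islimpt_def by blast
    moreover have "y \<in> X" using sub[OF F] y by blast
    ultimately have "g y < e" "g y \<ge> 0" "g y \<noteq> 0" using A(2) g(2)[of y] g(3)[of y] by auto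
    then show ?thesis using y by force
  qed
  obtain D :: "real set" where D: "countable D" "D \<subseteq> {0..1}" "{0..1} \<subseteq> closure D"
    using separable by metis
  \<comment> \<open>The factor \<open>nat\<close> makes every pair of a set and a target value recur
    infinitely often in the enumeration \<open>s\<close>; a single visit would not give points
    arbitrarily close to \<open>x\<close>.\<close>
  define I where "I = \<F> \<times> D \<times> (UNIV :: nat set)"
  define s where "s = from_nat_into I"
  have "D \<noteq> {}" using D(3) by auto
  then have I: "I \<noteq> {}" "countable I" using False \<open>countable \<F>\<close> D(1) by (auto simp: I_def)
  have sI: "s m \<in> I" for m using from_nat_into[OF I(1)] by (simp add: s_def)
  define q where "q m = fst (snd (s m))" for m
  have q: "q m \<in> {0..1}" for m using sI[of m] D(2) by (auto simp: I_def q_def mem_Times_iff)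
  have iF: "fst (s m) \<in> \<F>" for m using sI[of m] by (auto simp: I_def mem_Times_iff)
  have inf: "infinite {m. fst (s m) = F \<and> q m = d}" if "F \<in> \<F>" "d \<in> D" for F d
  proof
    assume fin: "finite {m. fst (s m) = F \<and> q m = d}"
    have "k \<in> (\<lambda>m. snd (snd (s m))) ` {m. fst (s m) = F \<and> q m = d}" for k
    proof -
      have "(F, d, k) \<in> I" using that by (simp add: I_def)
      then obtain m where "s m = (F, d, k)" using from_nat_into_surj[OF I(2)] s_def by metis
      then show ?thesis by (intro image_eqI[of _ _ m]) (auto simp: q_def)
    qed
    then have *: "UNIV \<subseteq> (\<lambda>m. snd (snd (s m))) ` {m. fst (s m) = F \<and> q m = d}" by blast
    show False using finite_surj[OF fin *] by simp
  qed
  have "\<exists>y. \<forall>m. (y m \<in> fst (s m) \<and> y m \<noteq> x \<and> 0 < g (y m) \<and> g (y m) < 1 / Suc m) \<and> g (y (Suc m)) < g (y m)"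
  proof (rule dependent_nat_choice)
    show "\<exists>z. z \<in> fst (s 0) \<and> z \<noteq> x \<and> 0 < g z \<and> g z < 1 / Suc 0"
      using small[OF iF, of 1 0] by auto
    fix z m assume "z \<in> fst (s m) \<and> z \<noteq> x \<and> 0 < g z \<and> g z < 1 / Suc m"
    then show "\<exists>w. (w \<in> fst (s (Suc m)) \<and> w \<noteq> x \<and> 0 < g w \<and> g w < 1 / Suc (Suc m)) \<and> g w < g z"
      using small[OF iF, of "min (g z) (1 / Suc (Suc m))" "Suc m"] by auto
  qed
  then obtain y where y: "\<And>m. y m \<in> fst (s m)" "\<And>m. y m \<noteq> x" "\<And>m. 0 < g (y m)"
      "\<And>m. g (y m) < 1 / Suc m" "\<And>m. g (y (Suc m)) < g (y m)" by blast
  define r where "r m = g (y m)" for m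
  have injr: "inj r"
  proof -
    have "strict_mono (\<lambda>m. - r m)" using y(5) by (simp add: strict_mono_Suc_iff r_def)
    then have "inj (\<lambda>m. - r m)" by (rule strict_mono_imp_inj_on)
    then show ?thesis by (auto simp: inj_def)
  qed
  \<comment> \<open>The radii are distinct and tend to 0, so \<open>R\<close> and all its subsets
    are closed in (0, \<infinity>). Hence any assignment of values on \<open>R\<close> is continuous
    and extends by Tietze.\<close>
  define R where "R = range r"
  have nolim: "\<not> z islimpt R'" if "R' \<subseteq> R" "z > 0" for R' z
  proof
    assume "z islimpt R'"
    then have inf': "infinite (R' \<inter> ball z (z/2))"
      using islimpt_eq_infinite_ball that by (metis half_gt_zero)
    obtain N where N: "1 / real (Suc N) < z/2" using nat_approx_posE half_gt_zero[OF \<open>z > 0\<close>] by metis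
    have "r m < z/2" if "m \<ge> N" for m
    proof -
      have "1 / real (Suc m) \<le> 1 / real (Suc N)" using that by (intro divide_left_mono) auto
      then show ?thesis using N y(4)[of m] by (simp add: r_def)
    qed
    moreover have "r m > z/2" if "r m \<in> ball z (z/2)" for m
    proof -
      have "\<bar>z - r m\<bar> < z/2" using that by (simp add: dist_real_def)
      then show ?thesis by linarith
    qed
    ultimately have "R' \<inter> ball z (z/2) \<subseteq> r ` {..<N}"
      using \<open>R' \<subseteq> R\<close> unfolding R_def
      by (smt (verit, best) IntE image_iff lessThan_iff not_le_imp_less rangeE subset_eq)
    then show False using inf' finite_subset by blast
  qed
  have Rpos: "R \<subseteq> {0<..}" using y(3) by (auto simp: R_def r_def)
  have cl: "closedin (top_of_set {0<..}) R'" if "R' \<subseteq> R" for R'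
    unfolding closedin_limpt using nolim[OF that] that Rpos by auto
  define \<psi> where "\<psi> = q \<circ> inv r"
  have \<psi>r: "\<psi> (r m) = q m" for m using injr by (simp add: \<psi>_def)
  have "continuous_on R \<psi>"
    unfolding continuous_on_closed
  proof (intro allI impI)
    fix T
    show "closedin (top_of_set R) (R \<inter> \<psi> -` T)"
      by (rule closedin_subset_trans[OF cl _ Rpos]) auto
  qed
  then obtain \<phi> where \<phi>: "continuous_on {0<..} \<phi>" "\<And>z. z \<in> R \<Longrightarrow> \<phi> z = \<psi> z"
      "\<And>z. z \<in> {0<..} \<Longrightarrow> \<phi> z \<in> cbox 0 1"
    using Tietze_closed_interval[of R \<psi> "{0<..}" 0 "1::real"] cl[OF order_refl] q
    by (auto simp: \<psi>_def)
  define h where "h z = (if g z > 0 then \<phi> (g z) else 0)" for z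
  show ?thesis
  proof (rule that[of h])
    have pos: "g z > 0" if "z \<in> X - {x}" for z using g(2)[of z] g(3)[of z] that by auto
    have "continuous_on (X - {x}) (\<lambda>z. \<phi> (g z))"
      by (rule continuous_on_compose2[OF \<phi>(1)])
        (use continuous_on_subset[OF g(1)] pos in \<open>auto simp: image_subset_iff\<close>)
    then show "continuous_on (X - {x}) h"
      by (subst continuous_on_cong[OF refl, of _ _ "\<lambda>z. \<phi> (g z)"]) (use pos in \<open>force simp: h_def\<close>)+
    show "h z \<in> {0..1}" for z using \<phi>(3)[of "g z"] by (auto simp: h_def)
    fix F t and U :: "('a \<times> real) set"
    assume *: "F \<in> \<F>" "t \<in> {0..1}" "open U" "(x, t) \<in> U"
    then obtain A B where AB: "open A" "open B" "x \<in> A" "t \<in> B" "A \<times> B \<subseteq> U"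
      by (metis open_prod_elim mem_Sigma_iff)
    obtain e where e: "e > 0" "\<And>z. z \<in> X \<Longrightarrow> g z < e \<Longrightarrow> z \<in> A" using near[OF AB(1,3)] by blast
    obtain d where d: "d \<in> D" "d \<in> B"
      using D(3) *(2) AB(2,4) by (meson closure_iff_nhds_not_empty disjoint_iff subset_iff order_refl)
    obtain N where N: "1 / real (Suc N) < e" using nat_approx_posE[OF e(1)] by metis
    obtain m where m: "m \<ge> N" "fst (s m) = F" "q m = d"
      using inf[OF *(1) d(1)] unfolding infinite_nat_iff_unbounded_le by auto
    have "1 / real (Suc m) \<le> 1 / real (Suc N)" using m by (intro divide_left_mono) auto
    then have "g (y m) < e" using y(4)[of m] N by linarith
    moreover have "y m \<in> F" using y(1)[of m] m by simp
    ultimately have "y m \<in> A" using e(2) sub[OF *(1)] by blast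
    moreover have "h (y m) = d"
      using y(3)[of m] \<phi>(2)[of "r m"] \<psi>r[of m] m by (simp add: h_def r_def R_def)
    ultimately show "\<exists>z\<in>F. z \<noteq> x \<and> (z, h z) \<in> U"
      using \<open>y m \<in> F\<close> y(2)[of m] d AB(5) by (intro bexI[of _ "y m"]) auto
  qed
qed

text \<open>Above \<open>x\<close> the set contains the whole vertical line, so oscillation of
  \<open>h\<close> at \<open>x\<close> does no harm; elsewhere the graph of a continuous function is
  relatively closed.\<close>

lemma closed_graph_off_point:
  fixes h :: "'a::topological_space \<Rightarrow> real"
  assumes T2: "Hausdorff_space (euclidean :: 'a topology)" and "closed X" "continuous_on (X - {x}) h"
  shows "closed {(y, t). y \<in> X \<and> (y \<noteq> x \<longrightarrow> t = h y)}"
proof -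
  have "continuous_on ((X - {x}) \<times> UNIV) (\<lambda>p. snd p - h (fst p))"
    by (intro continuous_intros continuous_on_compose2[OF assms(3)]) auto
  then obtain A where A: "open A"
      "A \<inter> (X - {x}) \<times> UNIV = (\<lambda>p. snd p - h (fst p)) -` (- {0}) \<inter> (X - {x}) \<times> UNIV"
    unfolding continuous_on_open_invariant
    by (metis (no_types, lifting) open_Compl closed_singleton)
  have "closed {x}" by (rule compact_imp_closed_Hausdorff[OF T2]) simp
  then have "open ((- X) \<times> UNIV \<union> A \<inter> (- {x}) \<times> (UNIV :: real set))"
    using A(1) \<open>closed X\<close> by (intro open_Un open_Int open_Times) auto
  moreover have "- {(y, t). y \<in> X \<and> (y \<noteq> x \<longrightarrow> t = h y)} = (- X) \<times> UNIV \<union> A \<inter> (- {x}) \<times> UNIV"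
  proof -
    have "(y, t) \<in> A \<longleftrightarrow> t \<noteq> h y" if "y \<in> X" "y \<noteq> x" for y t
    proof -
      have "(y, t) \<in> A \<inter> (X - {x}) \<times> UNIV \<longleftrightarrow> t \<noteq> h y" using A(2) that by simp
      then show ?thesis using that by blast
    qed
    then show ?thesis by blast
  qed
  ultimately show ?thesis by (simp add: closed_def)
qed

section \<open>Packing a sequence in [0,1] into one real number\<close>

lemma compact_PiE_UNIV:
  fixes S :: "'i \<Rightarrow> 'b::topological_space set"
  assumes "\<And>i. compact (S i)"
  shows "compact (PiE UNIV S)"
  using compactin_PiE[of "\<lambda>_. euclidean" UNIV S] assms by (simp add: euclidean_product_topology)

text \<open>The weights sum to 1, which keeps the value in [0,1]. The map is not injective on
  sequences; injectivity in each single coordinate suffices, because above a point that is split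
  exactly one coordinate is free.\<close>

definition binary_sum :: "(nat \<Rightarrow> real) \<Rightarrow> real"
  where "binary_sum \<tau> = (\<Sum>n. (1/2) ^ Suc n * \<tau> n)"

lemma summable_binary_sum:
  assumes "\<tau> \<in> PiE UNIV (\<lambda>_. {0..1})"
  shows "summable (\<lambda>n. (1/2::real) ^ Suc n * \<tau> n)"
proof (rule summable_comparison_test)
  show "summable (\<lambda>n. (1/2::real) ^ Suc n)" using power_half_series sums_summable by blast
  show "\<exists>N. \<forall>n\<ge>N. norm ((1/2) ^ Suc n * \<tau> n) \<le> (1/2) ^ Suc n"
    using assms by (auto simp: PiE_iff abs_mult intro!: mult_left_le)
qed

lemma binary_sum_range:
  assumes "\<tau> \<in> PiE UNIV (\<lambda>_. {0..1})"
  shows "binary_sum \<tau> \<in> {0..1}"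
proof -
  have "binary_sum \<tau> \<le> (\<Sum>n. (1/2) ^ Suc n)"
    unfolding binary_sum_def
    by (rule suminf_le[OF _ summable_binary_sum[OF assms] sums_summable[OF power_half_series]])
      (use assms in \<open>auto simp: PiE_iff intro!: mult_left_le\<close>)
  moreover have "0 \<le> binary_sum \<tau>"
    unfolding binary_sum_def using assms
    by (intro suminf_nonneg summable_binary_sum[OF assms]) (auto simp: PiE_iff)
  ultimately show ?thesis using sums_unique[OF power_half_series] by simp
qed

lemma continuous_on_binary_sum: "continuous_on (PiE UNIV (\<lambda>_. {0..1})) binary_sum"
proof -
  have "uniform_limit (PiE UNIV (\<lambda>_. {0..1})) (\<lambda>n \<tau>. \<Sum>i<n. (1/2) ^ Suc i * \<tau> i) binary_sum sequentially"
    unfolding binary_sum_def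
  proof (rule Weierstrass_m_test)
    show "summable (\<lambda>n. (1/2::real) ^ Suc n)" using power_half_series sums_summable by blast
    show "norm ((1/2) ^ Suc n * \<tau> n) \<le> (1/2) ^ Suc n" if "\<tau> \<in> PiE UNIV (\<lambda>_. {0..1})" for n and \<tau> :: "nat \<Rightarrow> real"
      using that by (auto simp: PiE_iff abs_mult intro!: mult_left_le)
  qed
  moreover have "continuous_on A (\<lambda>\<tau>::nat \<Rightarrow> real. \<Sum>i<n. (1/2) ^ Suc i * \<tau> i)" for A n
    by (intro continuous_intros continuous_on_product_then_coordinatewise)
  ultimately show ?thesis
    using uniform_limit_theorem by (metis (no_types, lifting) always_eventually trivial_limit_sequentially)
qed

lemma binary_sum_inject_single:
  assumes "\<tau> \<in> PiE UNIV (\<lambda>_. {0..1})" "t \<in> {0..1}" "u \<in> {0..1}"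
    and "binary_sum (\<tau>(n := t)) = binary_sum (\<tau>(n := u))"
  shows "t = u"
proof -
  have *: "\<tau>(n := v) \<in> PiE UNIV (\<lambda>_. {0..1})" if "v \<in> {0..1}" for v
    using assms(1) that by (auto simp: PiE_iff)
  have "(\<Sum>m. (1/2) ^ Suc m * (\<tau>(n := t)) m - (1/2) ^ Suc m * (\<tau>(n := u)) m) = 0"
    using suminf_diff[OF summable_binary_sum[OF *[OF assms(2)]] summable_binary_sum[OF *[OF assms(3)]]] assms(4)
    by (simp add: binary_sum_def)
  moreover have "(\<lambda>m. (1/2) ^ Suc m * (\<tau>(n := t)) m - (1/2) ^ Suc m * (\<tau>(n := u)) m)
      = (\<lambda>m. if m = n then (1/2) ^ Suc n * (t - u) else 0)"
    by (auto simp: fun_eq_iff right_diff_distrib simp del: power_Suc)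
  moreover have "(\<Sum>m. if m = n then (1/2) ^ Suc n * (t - u) else 0) = (1/2) ^ Suc n * (t - u)"
    using sums_single[of n "\<lambda>_. (1/2) ^ Suc n * (t - u)"] sums_unique by fastforce
  ultimately show ?thesis by simp
qed

text \<open>
  All points of \<open>L\<close> are blown up to intervals at once.  The relation \<open>K\<close> is the image of a compact
  set \<open>M\<close> of pairs \<open>(y, \<tau>)\<close>, where \<open>\<tau> n\<close> is the value at \<open>y\<close> of a function oscillating at the
  \<open>n\<close>-th point of \<open>L\<close> and is arbitrary if \<open>y\<close> is that point; the map \<open>\<tau> \<mapsto> binary_sum \<tau>\<close> packs the
  sequence into one coordinate.  The last clause says that \<open>K \<rightarrow> X\<close> is irreducible over each \<open>F \<in> \<F>\<close>.
\<close>

lemma ex_irreducible_splitting: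
  fixes X L :: "'a::topological_space set"
  assumes T2: "Hausdorff_space (euclidean :: 'a topology)" and "compact X" "countable L" "L \<subseteq> X"
    and g: "\<And>x. x \<in> L \<Longrightarrow> \<exists>g::'a \<Rightarrow> real. continuous_on X g \<and> (\<forall>y\<in>X. 0 \<le> g y \<and> (g y = 0 \<longleftrightarrow> y = x))"
    and "countable \<F>" and sub: "\<And>F. F \<in> \<F> \<Longrightarrow> F \<subseteq> X"
    and lim: "\<And>F x. F \<in> \<F> \<Longrightarrow> x \<in> L \<Longrightarrow> x \<in> F \<Longrightarrow> x islimpt F"
  obtains K :: "('a \<times> real) set" where "closed K" "K \<subseteq> X \<times> {0..1}"
    "\<And>x. x \<in> X \<Longrightarrow> \<exists>t. (x, t) \<in> K"
    "\<And>x t s. x \<notin> L \<Longrightarrow> (x, t) \<in> K \<Longrightarrow> (x, s) \<in> K \<Longrightarrow> t = s"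
    "\<And>x. x \<in> L \<Longrightarrow> uncountable {t. (x, t) \<in> K}"
    "\<And>F x t U. F \<in> \<F> \<Longrightarrow> x \<in> F \<Longrightarrow> (x, t) \<in> K \<Longrightarrow> open U \<Longrightarrow> (x, t) \<in> U \<Longrightarrow>
       \<exists>W. open W \<and> W \<inter> F \<noteq> {} \<and> (\<forall>y\<in>W. \<forall>s. (y, s) \<in> K \<longrightarrow> (y, s) \<in> U)"
proof -
  have "\<exists>h :: 'a \<Rightarrow> real. continuous_on (X - {x}) h \<and> (\<forall>y. h y \<in> {0..1}) \<and>
     (\<forall>F t U. F \<in> \<F> \<and> x \<in> F \<and> t \<in> {0..1} \<and> open U \<and> (x, t) \<in> U \<longrightarrow> (\<exists>y\<in>F. y \<noteq> x \<and> (y, h y) \<in> U))"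
    if x: "x \<in> L" for x
  proof -
    obtain g :: "'a \<Rightarrow> real" where g: "continuous_on X g" "\<And>y. y \<in> X \<Longrightarrow> 0 \<le> g y"
        "\<And>y. y \<in> X \<Longrightarrow> g y = 0 \<longleftrightarrow> y = x"
      using g[OF x] by blast
    show ?thesis
      by (rule ex_oscillating_function[OF \<open>compact X\<close> _ g, of "{F \<in> \<F>. x \<in> F}"])
        (use x \<open>L \<subseteq> X\<close> \<open>countable \<F>\<close> sub lim in \<open>auto simp: subset_iff\<close>)
  qed
  then obtain h :: "'a \<Rightarrow> 'a \<Rightarrow> real" where h: "\<And>x. x \<in> L \<Longrightarrow> continuous_on (X - {x}) (h x)"
      "\<And>x y. x \<in> L \<Longrightarrow> h x y \<in> {0..1}"
      "\<And>x F t U. x \<in> L \<Longrightarrow> F \<in> \<F> \<Longrightarrow> x \<in> F \<Longrightarrow> t \<in> {0..1} \<Longrightarrow> open U \<Longrightarrow> (x, t) \<in> U \<Longrightarrow>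
         \<exists>y\<in>F. y \<noteq> x \<and> (y, h x y) \<in> U"
    by metis
  have clX: "closed X" by (rule compact_imp_closed_Hausdorff[OF T2 \<open>compact X\<close>])
  \<comment> \<open>\<open>S n\<close> holds the \<open>n\<close>-th point of \<open>L\<close>. For
    finite \<open>L\<close> it is empty from some \<open>n\<close> on, and coordinate
    \<open>n\<close> is then constantly 0.\<close>
  define S where "S n = {x \<in> L. to_nat_on L x = n}" for n
  have S: "S (to_nat_on L x) = {x}" if "x \<in> L" for x
    using that \<open>countable L\<close> by (auto simp: S_def)
  have S_cases: "S n = {} \<or> (\<exists>x\<in>L. S n = {x} \<and> n = to_nat_on L x)" for n
    using S by (auto simp: S_def)
  have SL: "x \<in> S n \<longleftrightarrow> x \<in> L \<and> n = to_nat_on L x" for x n by (auto simp: S_def)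
  define H where "H n y = (if S n = {} then 0 else h (from_nat_into L n) y)" for n y
  have Hx: "H (to_nat_on L x) y = h x y" if "x \<in> L" for x y
    using S[OF that] that \<open>countable L\<close> by (simp add: H_def)
  have H01: "H n y \<in> {0..1}" for n y
  proof (cases "S n = {}")
    case False
    then obtain x where "x \<in> L" "n = to_nat_on L x" using S_cases by blast
    then show ?thesis using h(2) Hx by simp
  qed (simp add: H_def)
  define C where "C n = {(y, t). y \<in> X \<and> (y \<notin> S n \<longrightarrow> t = H n y)}" for n
  have "closed (C n)" for n
    using S_cases[of n]
  proof
    assume *: "S n = {}"
    then have "C n = X \<times> {0}" by (auto simp: C_def H_def)
    then show ?thesis using clX by (simp add: closed_Times)
  next
    assume "\<exists>x\<in>L. S n = {x} \<and> n = to_nat_on L x"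
    then obtain x where x: "x \<in> L" "S n = {x}" "n = to_nat_on L x" by blast
    show ?thesis
      using closed_graph_off_point[OF T2 clX h(1)[OF x(1)]] x Hx[OF x(1)] by (simp add: C_def)
  qed
  define I where "I = (PiE UNIV (\<lambda>_. {0..1}) :: (nat \<Rightarrow> real) set)"
  define M where "M = X \<times> I \<inter> (\<Inter>n. (\<lambda>p. (fst p, snd p n)) -` C n)"
  have M_iff: "(y, \<tau>) \<in> M \<longleftrightarrow> y \<in> X \<and> \<tau> \<in> I \<and> (\<forall>n. y \<notin> S n \<longrightarrow> \<tau> n = H n y)" for y \<tau>
    by (auto simp: M_def C_def)
  have coord: "continuous_on UNIV (\<lambda>p::'a \<times> (nat \<Rightarrow> real). (fst p, snd p n))" for n
    by (intro continuous_intros continuous_on_product_then_coordinatewise)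
  have "compact I" unfolding I_def by (rule compact_PiE_UNIV) simp
  have "closed (\<Inter>n. (\<lambda>p::'a \<times> (nat \<Rightarrow> real). (fst p, snd p n)) -` C n)"
    by (intro closed_INT ballI closed_vimage \<open>closed (C _)\<close> coord)
  then have cM: "compact M"
    unfolding M_def by (intro compact_Int_closed compact_Times \<open>compact X\<close> \<open>compact I\<close>)
  define \<Psi> where "\<Psi> p = (fst p, binary_sum (snd p))" for p :: "'a \<times> (nat \<Rightarrow> real)"
  have c\<Psi>: "continuous_on M \<Psi>"
    unfolding \<Psi>_def
    by (intro continuous_intros continuous_on_compose2[OF continuous_on_binary_sum])
      (auto simp: M_def I_def)
  define K where "K = \<Psi> ` M"
  have K_iff: "(y, s) \<in> K \<longleftrightarrow> (\<exists>\<tau>. (y, \<tau>) \<in> M \<and> s = binary_sum \<tau>)" for y s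
    unfolding K_def \<Psi>_def image_iff by force
  have cK: "compact K" unfolding K_def by (rule compact_continuous_image[OF c\<Psi> cM])
  have HM: "(y, \<lambda>n. H n y) \<in> M" if "y \<in> X" for y
    using that H01 by (auto simp: M_iff I_def PiE_iff)
  show ?thesis
  proof (rule that[of K])
    show "closed K"
      by (rule compact_imp_closed_Hausdorff[OF Hausdorff_space_euclidean_prod[OF T2] cK])
    show "K \<subseteq> X \<times> {0..1}"
    proof (rule subrelI)
      fix y s assume "(y, s) \<in> K"
      then show "(y, s) \<in> X \<times> {0..1}" using binary_sum_range by (auto simp: K_iff M_iff I_def)
    qed
    show "\<exists>t. (x, t) \<in> K" if "x \<in> X" for x using HM[OF that] K_iff by blast
    have uniq: "\<tau> = (\<lambda>n. H n x)" if "x \<notin> L" "(x, \<tau>) \<in> M" for x \<tau>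
      using that by (auto simp: M_iff SL)
    then show "t = s" if "x \<notin> L" "(x, t) \<in> K" "(x, s) \<in> K" for x t s
      using that unfolding K_iff by metis
    show "uncountable {t. (x, t) \<in> K}" if x: "x \<in> L" for x
    proof
      let ?n = "to_nat_on L x" and ?f = "\<lambda>n. H n x"
      let ?b = "\<lambda>t. binary_sum (?f(?n := t))"
      assume c: "countable {t. (x, t) \<in> K}"
      have fI: "?f \<in> I" using H01 by (auto simp: I_def PiE_iff)
      have "(x, ?b t) \<in> K" if "t \<in> {0..1}" for t
        unfolding K_iff
        by (rule exI[of _ "?f(?n := t)"])
          (use that fI x \<open>L \<subseteq> X\<close> S[OF x] in \<open>auto simp: M_iff I_def PiE_iff SL\<close>)
      then have "countable (?b ` {0..1})" by (intro countable_subset[OF _ c]) auto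
      moreover have "inj_on ?b {0..1}"
        using binary_sum_inject_single[of ?f] fI unfolding I_def by (intro inj_onI) blast
      ultimately have "countable {0..1::real}" using countable_image_inj_on by blast
      then show False using uncountable_closed_interval[of 0 "1::real"] by simp
    qed
    fix F x t and U :: "('a \<times> real) set"
    assume *: "F \<in> \<F>" "x \<in> F" "(x, t) \<in> K" "open U" "(x, t) \<in> U"
    obtain \<tau> where \<tau>: "(x, \<tau>) \<in> M" "t = binary_sum \<tau>" using *(3) K_iff by blast
    have "\<exists>y\<in>F. \<forall>\<rho>. (y, \<rho>) \<in> M \<longrightarrow> (y, binary_sum \<rho>) \<in> U"
    proof (cases "x \<in> L")
      case False
      then show ?thesis using uniq[OF False] * \<tau> by blast
    next
      case True
      let ?n = "to_nat_on L x"
      obtain A where A: "open A" "A \<inter> M = \<Psi> -` U \<inter> M"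
        using c\<Psi> *(4) unfolding continuous_on_open_invariant by metis
      \<comment> \<open>\<open>Q\<close> records coordinate \<open>?n\<close> of the lifts outside
        \<open>A\<close>. Above \<open>x\<close> all other coordinates are forced, so
        \<open>(x, \<tau> ?n)\<close> lies off the closed set \<open>Q\<close>. The oscillation of
        \<open>h x\<close> then gives \<open>y\<close> in \<open>F\<close> with
        \<open>(y, h x y)\<close> off \<open>Q\<close>, and so the whole fibre above
        \<open>y\<close> lands in \<open>U\<close>, even if \<open>y\<close> is itself a split
        point.\<close>
      define Q where "Q = (\<lambda>p. (fst p, snd p ?n)) ` (M - A)"
      have "compact Q"
        unfolding Q_def using continuous_on_subset[OF coord] compact_diff[OF cM A(1)]
        by (intro compact_continuous_image) auto
      then have "closed Q"
        using compact_imp_closed_Hausdorff[OF Hausdorff_space_euclidean_prod[OF T2]] by blast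
      have "(x, \<tau> ?n) \<notin> Q"
      proof
        assume "(x, \<tau> ?n) \<in> Q"
        then obtain \<rho> where \<rho>: "(x, \<rho>) \<in> M" "(x, \<rho>) \<notin> A" "\<rho> ?n = \<tau> ?n"
          by (auto simp: Q_def)
        have "\<rho> m = \<tau> m" for m
          using \<rho>(1,3) \<tau>(1) by (cases "m = ?n") (auto simp: M_iff SL)
        then have "\<rho> = \<tau>" by blast
        then have "(x, \<tau>) \<in> A \<inter> M" using A(2) \<tau> *(5) by (auto simp: \<Psi>_def)
        then show False using \<rho> \<open>\<rho> = \<tau>\<close> by blast
      qed
      moreover have "\<tau> ?n \<in> {0..1}" using \<tau>(1) by (auto simp: M_iff I_def PiE_iff)
      ultimately obtain y where y: "y \<in> F" "y \<noteq> x" "(y, h x y) \<notin> Q"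
        using h(3)[OF True *(1,2), of "\<tau> ?n" "- Q"] \<open>closed Q\<close> by auto
      have "(y, binary_sum \<rho>) \<in> U" if "(y, \<rho>) \<in> M" for \<rho>
      proof -
        have "y \<notin> S ?n" using S[OF True] y by simp
        then have "\<rho> ?n = h x y" using that Hx[OF True] by (simp add: M_iff)
        then have "(y, \<rho>) \<in> A" using y(3) that unfolding Q_def by force
        then have "(y, \<rho>) \<in> \<Psi> -` U \<inter> M" using A(2) that by blast
        then show ?thesis by (simp add: \<Psi>_def)
      qed
      then show ?thesis using y by blast
    qed
    then obtain y where y: "y \<in> F" "\<And>\<rho>. (y, \<rho>) \<in> M \<Longrightarrow> (y, binary_sum \<rho>) \<in> U" by blast
    \<comment> \<open>Tube argument: the projection of the compact set \<open>K - U\<close> is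
      closed, and over its complement, which contains \<open>y\<close>, all fibres lie in
      \<open>U\<close>.\<close>
    have "compact (fst ` (K - U))"
      by (intro compact_continuous_image compact_diff cK *(4) continuous_intros)
    then have "closed (fst ` (K - U))" by (rule compact_imp_closed_Hausdorff[OF T2])
    moreover have "y \<notin> fst ` (K - U)" using y(2) by (auto simp: K_iff)
    ultimately show "\<exists>W. open W \<and> W \<inter> F \<noteq> {} \<and> (\<forall>y\<in>W. \<forall>s. (y, s) \<in> K \<longrightarrow> (y, s) \<in> U)"
      using y(1) by (intro exI[of _ "- fst ` (K - U)"]) force
  qed
qed

section \<open>Codes for boxes and the ordinal $\omega_1$\<close>

lemma uncountable_omega1: "uncountable (UNIV :: omega1 set)"
proof
  assume "countable (UNIV :: omega1 set)"
  then have "|UNIV :: omega1 set| \<le>o |UNIV :: nat set|"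
    unfolding countable_def using card_of_ordLeq[of "UNIV :: omega1 set" "UNIV :: nat set"] by auto
  then have "aleph1 \<le>o natLeq"
    using card_of_omega1 card_of_nat by (meson ordIso_ordLeq_trans ordIso_symmetric ordLeq_ordIso_trans)
  then show False
    using cardSuc_greater[OF natLeq_Card_order] not_ordLess_ordLeq by blast
qed

text \<open>Otherwise \<open>omega1\<close> would be a countable union of countable initial
  segments.\<close>

lemma countable_bounded_omega1:
  assumes "countable (S :: omega1 set)"
  shows "\<exists>\<alpha>. \<forall>s\<in>S. s < \<alpha>"
proof (rule ccontr)
  assume "\<not> ?thesis"
  then have "UNIV \<subseteq> (\<Union>s\<in>S. {..s})" by (force simp: not_less)
  moreover have "countable {..s}" for s :: omega1
    using countable_lessThan_omega1[of s] by (simp add: lessThan_Suc_atMost flip: ivl_disj_un_singleton(2))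
  ultimately show False
    using uncountable_omega1 assms countable_UN countable_subset by metis
qed

lemma gt_ex_omega1: "\<exists>\<beta>. \<alpha> < (\<beta>::omega1)"
  using countable_bounded_omega1[of "{\<alpha>}"] by auto

lemma card_of_lists_ordLeq:
  assumes "infinite (A :: 'a set)"
  shows "|lists A| \<le>o |A|"
proof -
  define P where "P n = {xs \<in> lists A. length xs = n}" for n
  have "|P n| \<le>o |A|" for n
  proof (induction n)
    case 0
    have "P 0 = {[]}" by (auto simp: P_def)
    moreover obtain a where "a \<in> A" using assms infinite_imp_nonempty by blast
    ultimately have "inj_on (\<lambda>_. a) (P 0)" "(\<lambda>_. a) ` P 0 \<subseteq> A" by auto
    then show ?case using card_of_ordLeq by blast
  next
    case (Suc n)
    have "P (Suc n) \<subseteq> (\<lambda>(x, xs). x # xs) ` (A \<times> P n)"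
    proof
      fix ys assume "ys \<in> P (Suc n)"
      then obtain x xs where "ys = x # xs" "x \<in> A" "xs \<in> P n"
        by (cases ys) (auto simp: P_def)
      then show "ys \<in> (\<lambda>(x, xs). x # xs) ` (A \<times> P n)" by force
    qed
    then have "|P (Suc n)| \<le>o |A \<times> P n|" using surj_imp_ordLeq by blast
    also have "|A \<times> P n| \<le>o |A|"
      by (rule card_of_Times_ordLeq_infinite_Field)
        (use assms Suc card_of_Card_order[of A] in \<open>auto simp: Field_card_of card_of_mono1\<close>)
    finally show ?case .
  qed
  moreover have "lists A = (\<Union>n. P n)" by (auto simp: P_def)
  moreover have "|UNIV :: nat set| \<le>o |A|" using assms infinite_iff_card_of_nat by blast
  ultimately show ?thesis using card_of_UNION_ordLeq_infinite[OF assms] by metis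
qed

text \<open>Used with pairs of rationals for the second component: lists of interval constraints,
  and hence basic boxes, get names in \<open>omega1\<close>. This is how a principle about sets of
  ordinals can speak about closed sets.\<close>

lemma ex_surj_omega1_lists:
  "\<exists>e :: omega1 \<Rightarrow> (omega1 \<times> 'c::countable) list. surj e"
proof -
  have inf: "infinite (UNIV :: omega1 set)" using uncountable_omega1 uncountable_infinite by blast
  have "|UNIV :: nat set| \<le>o |UNIV :: omega1 set|" using inf infinite_iff_card_of_nat by blast
  moreover have "|UNIV :: 'c set| \<le>o |UNIV :: nat set|"
    using card_of_ordLeq[of "UNIV :: 'c set" "UNIV :: nat set"] ex_inj by auto
  ultimately have "|UNIV :: 'c set| \<le>o |UNIV :: omega1 set|" using ordLeq_transitive by blast
  then have *: "|(UNIV :: omega1 set) \<times> (UNIV :: 'c set)| \<le>o |UNIV :: omega1 set|"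
    by (intro card_of_Times_ordLeq_infinite_Field)
      (use inf card_of_Card_order[of "UNIV :: omega1 set"] in \<open>auto simp: Field_card_of card_of_mono1\<close>)
  have "infinite (UNIV :: (omega1 \<times> 'c) set)" using inf by (simp add: finite_prod)
  then have "|lists (UNIV :: (omega1 \<times> 'c) set)| \<le>o |UNIV :: (omega1 \<times> 'c) set|"
    by (rule card_of_lists_ordLeq)
  then have "|UNIV :: (omega1 \<times> 'c) list set| \<le>o |UNIV :: omega1 set|"
    using * ordLeq_transitive by auto
  then show ?thesis
    using card_of_ordLeq2[of "UNIV :: (omega1 \<times> 'c) list set" "UNIV :: omega1 set"] by auto
qed

lemma lists_lessThan_bounded:
  fixes \<alpha> :: omega1
  assumes "l \<in> lists ({..<\<alpha>} \<times> UNIV)" "\<delta> < \<alpha>"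
  obtains \<beta> where "\<beta> < \<alpha>" "l \<in> lists ({..\<beta>} \<times> UNIV)"
proof -
  \<comment> \<open>The extra element \<open>\<delta>\<close> provides a maximum when the list is
    empty.\<close>
  let ?m = "Max (insert \<delta> (fst ` set l))"
  have "\<And>x. x \<in> set l \<Longrightarrow> fst x \<le> ?m" by (intro Max_ge) auto
  moreover have "?m \<in> insert \<delta> (fst ` set l)" by (intro Max_in) auto
  then have "?m < \<alpha>" using assms by (auto simp: in_lists_conv_set)
  ultimately show ?thesis by (intro that[of ?m]) (auto simp: in_lists_conv_set mem_Times_iff simp del: Max_insert)
qed

text \<open>A closing-off argument. There are only countably many lists over a countable ordinal, so
  their names are bounded, and iterating the bound \<omega> times leads to a closed ordinal. Closure
  under limits holds because a list mentions finitely many coordinates.\<close>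

lemma club_codes:
  fixes e :: "omega1 \<Rightarrow> (omega1 \<times> 'c::countable) list"
  assumes "surj e"
  shows "club {\<alpha>. (\<exists>\<delta>. \<delta> < \<alpha>) \<and> (\<forall>l\<in>lists ({..<\<alpha>} \<times> UNIV). \<exists>\<xi><\<alpha>. e \<xi> = l)}"
    (is "club ?C")
proof -
  have "\<exists>\<gamma>>\<beta>. \<forall>l\<in>lists ({..<\<beta>} \<times> UNIV). \<exists>\<xi><\<gamma>. e \<xi> = l" for \<beta>
  proof -
    have "countable (lists ({..<\<beta>} \<times> (UNIV :: 'c set)))"
      by (intro countable_lists countable_SIGMA countable_lessThan_omega1) auto
    then have "countable (insert \<beta> (inv e ` lists ({..<\<beta>} \<times> (UNIV :: 'c set))))" by simp
    then obtain \<gamma> where "\<forall>s\<in>insert \<beta> (inv e ` lists ({..<\<beta>} \<times> (UNIV :: 'c set))). s < \<gamma>"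
      using countable_bounded_omega1 by blast
    then show ?thesis using surj_f_inv_f[OF assms] by (intro exI[of _ \<gamma>]) blast
  qed
  then obtain c where c: "\<And>\<beta>. \<beta> < c \<beta>"
      "\<And>\<beta> l. l \<in> lists ({..<\<beta>} \<times> UNIV) \<Longrightarrow> \<exists>\<xi><c \<beta>. e \<xi> = l"
    by metis
  have "\<exists>\<gamma>\<in>?C. \<alpha> < \<gamma>" for \<alpha>
  proof -
    define a where "a n = (c ^^ n) \<alpha>" for n
    have aSuc: "a n < a (Suc n)" for n using c(1) by (simp add: a_def)
    define \<gamma> where "\<gamma> = (LEAST \<gamma>. \<forall>n. a n < \<gamma>)"
    have "\<exists>\<gamma>. \<forall>n. a n < \<gamma>" using countable_bounded_omega1[of "range a"] by auto
    from LeastI_ex[OF this] have \<gamma>: "\<And>n. a n < \<gamma>" unfolding \<gamma>_def by blast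
    have below: "\<exists>n. \<beta> < a n" if "\<beta> < \<gamma>" for \<beta>
    proof -
      have "\<exists>n. \<beta> \<le> a n" 
        using not_less_Least[of \<beta> "\<lambda>\<gamma>. \<forall>n. a n < \<gamma>"] that
        by (auto simp: \<gamma>_def[symmetric] not_less)
      then show ?thesis using aSuc order_le_less_trans by blast
    qed
    have "\<exists>\<xi><\<gamma>. e \<xi> = l" if l: "l \<in> lists ({..<\<gamma>} \<times> UNIV)" for l
    proof -
      obtain \<beta> where "\<beta> < \<gamma>" "l \<in> lists ({..\<beta>} \<times> UNIV)"
        using lists_lessThan_bounded[OF l \<gamma>[of 0]] by blast
      moreover then obtain n where "\<beta> < a n" using below by blast
      ultimately have "l \<in> lists ({..<a n} \<times> UNIV)" by (auto simp: in_lists_conv_set)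
      then obtain \<xi> where "\<xi> < c (a n)" "e \<xi> = l" using c(2) by blast
      moreover have "c (a n) < \<gamma>" using \<gamma>[of "Suc n"] by (simp add: a_def)
      ultimately show ?thesis using less_trans by blast
    qed
    moreover have "\<alpha> < \<gamma>" using \<gamma>[of 0] by (simp add: a_def)
    ultimately show ?thesis by blast
  qed
  moreover have "\<alpha> \<in> ?C" if "\<exists>\<beta>. \<beta> < \<alpha>" and lim: "\<forall>\<beta><\<alpha>. \<exists>\<gamma>\<in>?C. \<beta> < \<gamma> \<and> \<gamma> < \<alpha>" for \<alpha>
  proof -
    have "\<exists>\<xi><\<alpha>. e \<xi> = l" if l: "l \<in> lists ({..<\<alpha>} \<times> UNIV)" for l
    proof -
      obtain \<delta> where "\<delta> < \<alpha>" using \<open>\<exists>\<beta>. \<beta> < \<alpha>\<close> by blast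
      then obtain \<beta> where \<beta>: "\<beta> < \<alpha>" "l \<in> lists ({..\<beta>} \<times> UNIV)"
        using lists_lessThan_bounded[OF l] by blast
      then obtain \<gamma> where \<gamma>: "\<gamma> \<in> ?C" "\<beta> < \<gamma>" "\<gamma> < \<alpha>" using lim by blast
      then have "l \<in> lists ({..<\<gamma>} \<times> UNIV)" using \<beta> by (auto simp: in_lists_conv_set)
      then obtain \<xi> where "\<xi> < \<gamma>" "e \<xi> = l" using \<gamma>(1) by blast
      then show ?thesis using \<gamma>(3) less_trans by blast
    qed
    then show ?thesis using that(1) by blast
  qed
  ultimately show ?thesis unfolding club_def by blast
qed

lemma club_UNIV: "club UNIV"
  unfolding club_def using gt_ex_omega1 by blast

section \<open>Rational boxes in products of the real line\<close>

definition open_box :: "('i \<times> rat \<times> rat) list \<Rightarrow> ('i \<Rightarrow> real) set"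
  where "open_box l = {y. \<forall>(i, a, b)\<in>set l. of_rat a < y i \<and> y i < of_rat b}"

definition closed_box :: "('i \<times> rat \<times> rat) list \<Rightarrow> ('i \<Rightarrow> real) set"
  where "closed_box l = {y. \<forall>(i, a, b)\<in>set l. of_rat a \<le> y i \<and> y i \<le> of_rat b}"

lemma open_box_subset_closed_box: "open_box l \<subseteq> closed_box l"
  by (force simp: open_box_def closed_box_def)

lemma open_open_box:
  fixes l :: "('i \<times> rat \<times> rat) list"
  shows "open (open_box l)"
proof -
  have "open {y::'i \<Rightarrow> real. \<forall>k\<in>set l. y (fst k) \<in> {of_rat (fst (snd k))<..<of_rat (snd (snd k))}}"
    by (rule product_topology_basis') auto
  moreover have "{y. \<forall>k\<in>set l. y (fst k) \<in> {of_rat (fst (snd k))<..<of_rat (snd (snd k))}} = open_box l"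
    by (auto simp: open_box_def)
  ultimately show ?thesis by simp
qed

lemma closed_closed_box:
  fixes l :: "('i \<times> rat \<times> rat) list"
  shows "closed (closed_box l)"
proof -
  have *: "closed {y::'i \<Rightarrow> real. of_rat a \<le> y i \<and> y i \<le> of_rat b}" for i a b
    by (intro closed_Collect_conj closed_Collect_le continuous_intros
        continuous_on_product_coordinates)
  have "closed_box l = (\<Inter>(i, a, b)\<in>set l. {y. of_rat a \<le> y i \<and> y i \<le> of_rat b})"
    by (auto simp: closed_box_def)
  then show ?thesis using * by (auto intro!: closed_INT)
qed

lemma ex_rational_interval:
  assumes "open U" "(x::real) \<in> U"
  shows "\<exists>a b :: rat. of_rat a < x \<and> x < of_rat b \<and> {of_rat a..of_rat b} \<subseteq> U"
proof -
  obtain d where d: "d > 0" "cball x d \<subseteq> U" using assms open_contains_cball by blast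
  obtain a b where "x - d < of_rat a" "of_rat a < x" "x < of_rat b" "of_rat b < x + d"
    using of_rat_dense[of "x - d" x] of_rat_dense[of x "x + d"] d(1) by auto
  then have "{of_rat a..of_rat b} \<subseteq> cball x d" by (auto simp: dist_real_def)
  then show ?thesis using \<open>of_rat a < x\<close> \<open>x < of_rat b\<close> d(2) by blast
qed

lemma open_contains_finite_box:
  fixes U :: "('i \<Rightarrow> 'b::topological_space) set"
  assumes "open U" "x \<in> U"
  obtains I V where "finite I" "\<And>i. i \<in> I \<Longrightarrow> open (V i) \<and> x i \<in> V i" "{y. \<forall>i\<in>I. y i \<in> V i} \<subseteq> U"
proof -
  obtain V where V: "x \<in> PiE UNIV V" "\<And>i. open (V i)" "finite {i. V i \<noteq> UNIV}" "PiE UNIV V \<subseteq> U"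
    using product_topology_open_contains_basis[of "\<lambda>_. euclidean" UNIV U x] assms
    by (auto simp: euclidean_product_topology)
  show ?thesis
    by (rule that[of "{i. V i \<noteq> UNIV}" V]) (use V in \<open>auto simp: PiE_iff subset_iff, metis UNIV_I\<close>)
qed

lemma open_contains_box:
  fixes U :: "('i \<Rightarrow> real) set"
  assumes "open U" "x \<in> U"
  obtains l where "x \<in> open_box l" "closed_box l \<subseteq> U"
proof -
  obtain I V where IV: "finite I" "\<And>i. i \<in> I \<Longrightarrow> open (V i) \<and> x i \<in> V i" "{y. \<forall>i\<in>I. y i \<in> V i} \<subseteq> U"
    using open_contains_finite_box[OF assms] by blast
  then have "\<forall>i\<in>I. \<exists>a b :: rat. of_rat a < x i \<and> x i < of_rat b \<and> {of_rat a..of_rat b} \<subseteq> V i"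
    using ex_rational_interval by blast
  then obtain a b where ab: "\<And>i. i \<in> I \<Longrightarrow> of_rat (a i) < x i \<and> x i < of_rat (b i)
      \<and> {real_of_rat (a i)..of_rat (b i)} \<subseteq> V i" by metis
  obtain js where "set js = I" using finite_list[OF IV(1)] by blast
  then show ?thesis
    using ab IV(3)
    by (intro that[of "map (\<lambda>i. (i, a i, b i)) js"]) (force simp: open_box_def closed_box_def)+
qed

lemma open_contains_box_extensional:
  fixes U :: "('i \<Rightarrow> real) set"
  assumes "open U" "x \<in> U" "x \<in> extensional S"
  obtains l where "l \<in> lists (S \<times> UNIV)" "x \<in> open_box l" "closed_box l \<inter> extensional S \<subseteq> U"
proof -
  obtain l where l: "x \<in> open_box l" "closed_box l \<subseteq> U"
    using open_contains_box[OF assms(1,2)] by blast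
  let ?l = "filter (\<lambda>k. fst k \<in> S) l"
  have "y \<in> closed_box l" if "y \<in> closed_box ?l" "y \<in> extensional S" for y
  proof -
    have "of_rat a \<le> y i \<and> y i \<le> of_rat b" if k: "(i, a, b) \<in> set l" for i a b
    proof (cases "i \<in> S")
      case True
      then show ?thesis using k \<open>y \<in> closed_box ?l\<close> by (auto simp: closed_box_def)
    next
      case False
      then have "y i = x i" using assms(3) \<open>y \<in> extensional S\<close> by (simp add: extensional_def)
      then show ?thesis using k l(1) by (force simp: open_box_def)
    qed
    then show ?thesis by (auto simp: closed_box_def)
  qed
  then show ?thesis
    using l by (intro that[of ?l]) (auto simp: in_lists_conv_set open_box_def)
qed

lemma countable_lists_lessThan_omega1: "countable (lists ({..<\<alpha>::omega1} \<times> (UNIV :: 'c::countable set)))"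
  by (intro countable_lists countable_SIGMA countable_lessThan_omega1) auto

section \<open>Towers of splittings\<close>

lemma proj_proj: "\<gamma> \<le> \<beta> \<Longrightarrow> proj \<gamma> (proj \<beta> x) = proj \<gamma> x"
  by (auto simp: proj_def restrict_def fun_eq_iff)

lemma proj_apply: "\<gamma> < \<beta> \<Longrightarrow> proj \<beta> x \<gamma> = x \<gamma>"
  by (simp add: proj_def)

lemma proj_eq_iff: "proj \<beta> x = proj \<beta> y \<longleftrightarrow> (\<forall>\<gamma><\<beta>. x \<gamma> = y \<gamma>)"
  by (auto simp: proj_def restrict_def fun_eq_iff)

lemma proj_extensional_eq: "x \<in> extensional {..<\<beta>} \<Longrightarrow> proj \<beta> x = x"
  by (simp add: proj_def extensional_restrict)

lemma continuous_on_proj: "continuous_on A (proj \<beta>)"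
proof (rule continuous_on_coordinatewise_then_product)
  show "continuous_on A (\<lambda>x. proj \<beta> x i)" for i
    by (cases "i < \<beta>")
      (auto simp: proj_def intro: continuous_on_subset[OF continuous_on_product_coordinates])
qed

text \<open>Every coordinate is tested against the splitting relation of its own stage, so limit
  stages are inverse limits automatically. \<open>S\<close> is \<open>{..<\<alpha>}\<close> for
  stage \<alpha> and \<open>UNIV\<close> for the final space; fixing the values outside
  \<open>S\<close> lets all stages live in one type.\<close>

definition lim_space :: "(omega1 \<Rightarrow> ((omega1 \<Rightarrow> real) \<times> real) set) \<Rightarrow> omega1 set \<Rightarrow> (omega1 \<Rightarrow> real) set"
  where "lim_space K S = {x \<in> extensional S. \<forall>\<beta>\<in>S. (proj \<beta> x, x \<beta>) \<in> K \<beta>}"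

lemma lim_spaceD:
  assumes "x \<in> lim_space K S"
  shows "x \<in> extensional S" "\<beta> \<in> S \<Longrightarrow> (proj \<beta> x, x \<beta>) \<in> K \<beta>"
  using assms by (auto simp: lim_space_def)

lemma proj_in_lim_space:
  assumes "x \<in> lim_space K S" "{..<\<beta>} \<subseteq> S"
  shows "proj \<beta> x \<in> lim_space K {..<\<beta>}"
  using assms by (auto simp: lim_space_def proj_proj proj_apply) (simp add: proj_def)

lemma lim_space_cong: "(\<And>\<beta>. \<beta> \<in> S \<Longrightarrow> K \<beta> = K' \<beta>) \<Longrightarrow> lim_space K S = lim_space K' S"
  by (auto simp: lim_space_def)

text \<open>
  \<open>K \<beta>\<close> relates a point of the \<open>\<beta>\<close>-th space \<open>lim_space K {..<\<beta>}\<close> to its possible values at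
  coordinate \<open>\<beta>\<close>.  \<open>L \<beta>\<close> is the set of points that are split again at coordinate \<open>\<beta>\<close>; these sets
  form the levels of an Aronszajn tree.  \<open>F \<beta>\<close> is the closed set guessed at stage \<open>\<beta>\<close>.  The guess
  at stage \<open>0\<close> is ignored, because the only point of the one-point space there has to be split.
\<close>

definition level_ok ::
  "(omega1 \<Rightarrow> ((omega1 \<Rightarrow> real) \<times> real) set) \<Rightarrow> (omega1 \<Rightarrow> (omega1 \<Rightarrow> real) set) \<Rightarrow>
   (omega1 \<Rightarrow> (omega1 \<Rightarrow> real) set) \<Rightarrow> omega1 \<Rightarrow> bool"
  where "level_ok K L F \<alpha> \<longleftrightarrow>
    countable (L \<alpha>) \<and> L \<alpha> \<noteq> {} \<and> L \<alpha> \<subseteq> lim_space K {..<\<alpha>} \<and>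
    (\<forall>x\<in>L \<alpha>. \<forall>\<beta><\<alpha>. proj \<beta> x \<in> L \<beta>) \<and>
    (\<forall>\<beta><\<alpha>. \<forall>y\<in>L \<beta>. \<exists>x\<in>L \<alpha>. \<exists>x'\<in>L \<alpha>. x \<noteq> x' \<and> proj \<beta> x = y \<and> proj \<beta> x' = y) \<and>
    ((\<exists>\<delta>. \<delta> < \<alpha>) \<longrightarrow> (\<forall>x\<in>L \<alpha> \<inter> F \<alpha>. x islimpt F \<alpha>))"

text \<open>A pair in \<open>K \<alpha>\<close> is a point of stage \<alpha> together with its next
  coordinate, so \<open>K \<alpha>\<close> is a copy of the following stage. The last clause demands
  irreducibility of this single step over the preimages of all guesses so far; longer stretches
  follow by induction.\<close>

definition split_ok ::
  "(omega1 \<Rightarrow> ((omega1 \<Rightarrow> real) \<times> real) set) \<Rightarrow> (omega1 \<Rightarrow> (omega1 \<Rightarrow> real) set) \<Rightarrow>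
   (omega1 \<Rightarrow> (omega1 \<Rightarrow> real) set) \<Rightarrow> omega1 \<Rightarrow> bool"
  where "split_ok K L F \<alpha> \<longleftrightarrow>
    closed (K \<alpha>) \<and> K \<alpha> \<subseteq> lim_space K {..<\<alpha>} \<times> {0..1} \<and>
    (\<forall>x\<in>lim_space K {..<\<alpha>}. \<exists>t. (x, t) \<in> K \<alpha>) \<and>
    (\<forall>x t s. x \<notin> L \<alpha> \<and> (x, t) \<in> K \<alpha> \<and> (x, s) \<in> K \<alpha> \<longrightarrow> t = s) \<and>
    (\<forall>x\<in>L \<alpha>. uncountable {t. (x, t) \<in> K \<alpha>}) \<and>
    (\<forall>\<delta>\<le>\<alpha>. (\<exists>\<gamma>. \<gamma> < \<delta>) \<longrightarrow> (\<forall>x t U. (x, t) \<in> K \<alpha> \<and> proj \<delta> x \<in> F \<delta> \<and> open U \<and> (x, t) \<in> U \<longrightarrow>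
      (\<exists>W. open W \<and> (\<exists>y\<in>W. y \<in> lim_space K {..<\<alpha>} \<and> proj \<delta> y \<in> F \<delta>) \<and>
        (\<forall>y\<in>W. \<forall>s. (y, s) \<in> K \<alpha> \<longrightarrow> (y, s) \<in> U))))"

lemma level_okD:
  assumes "level_ok K L F \<alpha>"
  shows "countable (L \<alpha>)" "L \<alpha> \<noteq> {}" "L \<alpha> \<subseteq> lim_space K {..<\<alpha>}"
    "\<forall>x\<in>L \<alpha>. \<forall>\<beta><\<alpha>. proj \<beta> x \<in> L \<beta>"
    "\<forall>\<beta><\<alpha>. \<forall>y\<in>L \<beta>. \<exists>x\<in>L \<alpha>. \<exists>x'\<in>L \<alpha>. x \<noteq> x' \<and> proj \<beta> x = y \<and> proj \<beta> x' = y"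
    "(\<exists>\<delta>. \<delta> < \<alpha>) \<longrightarrow> (\<forall>x\<in>L \<alpha> \<inter> F \<alpha>. x islimpt F \<alpha>)"
  using assms unfolding level_ok_def by - (elim conjE, assumption)+

lemma split_okD:
  assumes "split_ok K L F \<alpha>"
  shows "closed (K \<alpha>)" "K \<alpha> \<subseteq> lim_space K {..<\<alpha>} \<times> {0..1}"
    "\<forall>x\<in>lim_space K {..<\<alpha>}. \<exists>t. (x, t) \<in> K \<alpha>"
    "\<forall>x t s. x \<notin> L \<alpha> \<and> (x, t) \<in> K \<alpha> \<and> (x, s) \<in> K \<alpha> \<longrightarrow> t = s"
    "\<forall>x\<in>L \<alpha>. uncountable {t. (x, t) \<in> K \<alpha>}"
    "\<forall>\<delta>\<le>\<alpha>. (\<exists>\<gamma>. \<gamma> < \<delta>) \<longrightarrow> (\<forall>x t U. (x, t) \<in> K \<alpha> \<and> proj \<delta> x \<in> F \<delta> \<and> open U \<and> (x, t) \<in> U \<longrightarrow>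
      (\<exists>W. open W \<and> (\<exists>y\<in>W. y \<in> lim_space K {..<\<alpha>} \<and> proj \<delta> y \<in> F \<delta>) \<and>
        (\<forall>y\<in>W. \<forall>s. (y, s) \<in> K \<alpha> \<longrightarrow> (y, s) \<in> U)))"
  using assms unfolding split_ok_def by - (elim conjE, assumption)+

lemma split_ok_irreducible:
  assumes "split_ok K L F \<alpha>" "\<delta> \<le> \<alpha>" "\<exists>\<gamma>. \<gamma> < \<delta>" "(x, t) \<in> K \<alpha>" "proj \<delta> x \<in> F \<delta>" "open U" "(x, t) \<in> U"
  obtains W z where "open W" "z \<in> W" "z \<in> lim_space K {..<\<alpha>}" "proj \<delta> z \<in> F \<delta>"
    "\<And>y s. y \<in> W \<Longrightarrow> (y, s) \<in> K \<alpha> \<Longrightarrow> (y, s) \<in> U"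
proof -
  have "\<exists>W. open W \<and> (\<exists>y\<in>W. y \<in> lim_space K {..<\<alpha>} \<and> proj \<delta> y \<in> F \<delta>) \<and>
      (\<forall>y\<in>W. \<forall>s. (y, s) \<in> K \<alpha> \<longrightarrow> (y, s) \<in> U)"
    using split_okD(6)[OF assms(1), rule_format, OF assms(2,3), of x t U] assms(4-7) by simp
  then show ?thesis using that by blast
qed

text \<open>An arbitrary initial segment \<open>S\<close> is allowed so that the same facts serve
  inside the recursion, with \<open>S = {..<\<alpha>}\<close>, and for the finished construction,
  with \<open>S = UNIV\<close>.\<close>

locale tower =
  fixes K :: "omega1 \<Rightarrow> ((omega1 \<Rightarrow> real) \<times> real) set" and L F :: "omega1 \<Rightarrow> (omega1 \<Rightarrow> real) set"
    and S :: "omega1 set"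
  assumes down: "\<beta> \<in> S \<Longrightarrow> \<gamma> < \<beta> \<Longrightarrow> \<gamma> \<in> S"
    and level: "\<beta> \<in> S \<Longrightarrow> level_ok K L F \<beta>"
    and split: "\<beta> \<in> S \<Longrightarrow> split_ok K L F \<beta>"
    and F_sub: "\<beta> \<in> S \<Longrightarrow> F \<beta> \<subseteq> lim_space K {..<\<beta>}"
begin

abbreviation X :: "omega1 set \<Rightarrow> (omega1 \<Rightarrow> real) set"
  where "X \<equiv> lim_space K"

lemma lim_space_range:
  assumes "x \<in> X T" "T \<subseteq> S" "\<beta> \<in> T"
  shows "x \<beta> \<in> {0..1}"
  using lim_spaceD(2)[OF assms(1,3)] split_okD(2)[OF split, of \<beta>] assms(2,3) by blast

lemma compact_lim_space:
  assumes "T \<subseteq> S"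
  shows "compact (X T)"
proof -
  define C where "C = (PiE UNIV (\<lambda>i. if i \<in> T then {0..1} else {undefined}) :: (omega1 \<Rightarrow> real) set)"
  have "compact C" unfolding C_def by (rule compact_PiE_UNIV) simp
  moreover have "closed (\<Inter>\<beta>\<in>T. (\<lambda>x. (proj \<beta> x, x \<beta>)) -` K \<beta>)"
  proof (intro closed_INT ballI closed_vimage)
    show "closed (K \<beta>)" if "\<beta> \<in> T" for \<beta>
      using split_okD(1)[OF split] assms that by blast
    show "continuous_on UNIV (\<lambda>x. (proj \<beta> x, x \<beta>))" for \<beta>
      by (intro continuous_intros continuous_on_proj continuous_on_product_coordinates)
  qed
  moreover have "X T = C \<inter> (\<Inter>\<beta>\<in>T. (\<lambda>x. (proj \<beta> x, x \<beta>)) -` K \<beta>)"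
  proof -
    have "x \<in> C" if "x \<in> X T" for x
      using lim_space_range[OF that assms] lim_spaceD(1)[OF that]
      by (auto simp: C_def PiE_iff extensional_def)
    then show ?thesis by (auto simp: lim_space_def C_def PiE_iff extensional_def split: if_splits)
  qed
  ultimately show ?thesis by (simp add: compact_Int_closed)
qed

text \<open>Each single step is onto, so the missing coordinates can be chosen by transfinite
  recursion.\<close>

lemma ex_extension:
  assumes "T \<subseteq> T'" "T' \<subseteq> S" and T': "\<And>\<beta> \<gamma>. \<beta> \<in> T' \<Longrightarrow> \<gamma> < \<beta> \<Longrightarrow> \<gamma> \<in> T'"
    and T: "\<And>\<beta> \<gamma>. \<beta> \<in> T \<Longrightarrow> \<gamma> < \<beta> \<Longrightarrow> \<gamma> \<in> T" and "y \<in> X T"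
  shows "\<exists>x\<in>X T'. restrict x T = y"
proof -
  \<comment> \<open>The premise \<open>proj \<gamma> f \<in> X {..<\<gamma>}\<close> keeps a choice
    of \<open>r\<close> possible for every \<open>f\<close>, even one that is not a thread. That the
    resulting function is a thread is proved afterwards by induction.\<close>
  define P where "P f \<gamma> r \<longleftrightarrow> (if \<gamma> \<in> T then r = y \<gamma> else if \<gamma> \<in> T' then
      (proj \<gamma> f \<in> X {..<\<gamma>} \<longrightarrow> (proj \<gamma> f, r) \<in> K \<gamma>) else r = undefined)" for f \<gamma> r
  have "\<exists>f. \<forall>\<gamma>. P f \<gamma> (f \<gamma>)"
  proof (rule dependent_wellorder_choice)
    show "P f \<gamma> r = P g \<gamma> r" if "\<And>\<beta>. \<beta> < \<gamma> \<Longrightarrow> f \<beta> = g \<beta>" for r f g \<gamma>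
    proof -
      have "proj \<gamma> f = proj \<gamma> g" using that by (simp add: proj_eq_iff)
      then show ?thesis by (simp add: P_def)
    qed
    show "\<exists>r. P f \<gamma> r" for \<gamma> f
    proof (cases "\<gamma> \<in> T' \<and> \<gamma> \<notin> T")
      case True
      then have "split_ok K L F \<gamma>" using split assms(2) by blast
      then have "proj \<gamma> f \<in> X {..<\<gamma>} \<longrightarrow> (\<exists>r. (proj \<gamma> f, r) \<in> K \<gamma>)"
        using split_okD(3) by blast
      then show ?thesis using True by (auto simp: P_def)
    qed (auto simp: P_def)
  qed
  then obtain f where f: "\<And>\<gamma>. P f \<gamma> (f \<gamma>)" by blast
  have fT: "f \<gamma> = y \<gamma>" if "\<gamma> \<in> T" for \<gamma> using f[of \<gamma>] that by (simp add: P_def)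
  have K: "(proj \<gamma> f, f \<gamma>) \<in> K \<gamma>" if "\<gamma> \<in> T'" for \<gamma>
    using that
  proof (induction \<gamma> rule: less_induct)
    case (less \<gamma>)
    show ?case
    proof (cases "\<gamma> \<in> T")
      case True
      then have "proj \<gamma> f = proj \<gamma> y" using fT T by (auto simp: proj_eq_iff)
      then show ?thesis using fT[OF True] lim_spaceD(2)[OF assms(5) True] by simp
    next
      case False
      have "(proj \<beta> f, f \<beta>) \<in> K \<beta>" if "\<beta> < \<gamma>" for \<beta>
        using less.IH that T' less.prems by blast
      then have "proj \<gamma> f \<in> X {..<\<gamma>}"
        by (auto simp: lim_space_def proj_proj proj_apply) (simp add: proj_def)
      then show ?thesis using f[of \<gamma>] False less.prems by (simp add: P_def)
    qed
  qed
  have "f \<gamma> = undefined" if "\<gamma> \<notin> T'" for \<gamma>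
  proof -
    have "\<gamma> \<notin> T" using that assms(1) by blast
    then show ?thesis using f[of \<gamma>] that by (simp add: P_def)
  qed
  then have "f \<in> X T'" using K by (auto simp: lim_space_def extensional_def)
  moreover have "restrict f T = y"
    using fT lim_spaceD(1)[OF assms(5)] by (auto simp: restrict_def extensional_def fun_eq_iff)
  ultimately show ?thesis by blast
qed

text \<open>Two values at a later coordinate would require a point of \<open>L\<close> at that
  level, and such points project into \<open>L \<alpha>\<close>. So a point outside
  \<open>L \<alpha>\<close> is never split again.\<close>

lemma eq_of_proj_eq:
  assumes "x \<in> X T" "y \<in> X T" "T \<subseteq> S" and T: "\<And>\<beta> \<gamma>. \<beta> \<in> T \<Longrightarrow> \<gamma> < \<beta> \<Longrightarrow> \<gamma> \<in> T"
    and "proj \<alpha> x = proj \<alpha> y" "proj \<alpha> x \<notin> L \<alpha>"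
  shows "x = y"
proof -
  have "x \<gamma> = y \<gamma>" for \<gamma>
  proof (induction \<gamma> rule: less_induct)
    case (less \<gamma>)
    have eq: "proj \<gamma> x = proj \<gamma> y" using less by (simp add: proj_eq_iff)
    show ?case
    proof (cases "\<gamma> \<in> T \<and> \<alpha> \<le> \<gamma>")
      case True
      have "level_ok K L F \<gamma>" using level True assms(3) by blast
      have "proj \<gamma> x \<notin> L \<gamma>"
      proof
        assume "proj \<gamma> x \<in> L \<gamma>"
        then have "proj \<alpha> x \<in> L \<alpha>"
          using level_okD(4)[OF \<open>level_ok K L F \<gamma>\<close>] True proj_proj[of \<alpha> \<gamma> x]
          by (cases "\<alpha> = \<gamma>") (auto, metis order_le_less)
        then show False using assms(6) by blast
      qed
      moreover have "(proj \<gamma> x, x \<gamma>) \<in> K \<gamma>" "(proj \<gamma> x, y \<gamma>) \<in> K \<gamma>"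
        using lim_spaceD(2)[OF assms(1)] lim_spaceD(2)[OF assms(2)] True eq by metis+
      ultimately show ?thesis using split_okD(4)[OF split[of \<gamma>]] True assms(3) by blast
    next
      case False
      then have "\<gamma> \<notin> T \<or> \<gamma> < \<alpha>" by auto
      then show ?thesis
        using assms(5) lim_spaceD(1)[OF assms(1)] lim_spaceD(1)[OF assms(2)]
        by (auto simp: proj_eq_iff extensional_def)
    qed
  qed
  then show ?thesis by blast
qed

text \<open>The projection \<open>X T \<rightarrow> X {..<\<delta>}\<close> is irreducible over \<open>F \<delta>\<close>: every nonempty relatively open
  part of the preimage of \<open>F \<delta>\<close> contains the preimage of a nonempty relatively open subset of \<open>F \<delta>\<close>.\<close>

lemma irreducible:
  assumes "T \<subseteq> S" and T: "\<And>\<beta> \<gamma>. \<beta> \<in> T \<Longrightarrow> \<gamma> < \<beta> \<Longrightarrow> \<gamma> \<in> T" and "{..<\<delta>} \<subseteq> T" "\<exists>\<gamma>. \<gamma> < \<delta>"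
    and "x \<in> X T" "proj \<delta> x \<in> F \<delta>" "open U" "x \<in> U"
  shows "\<exists>V. open V \<and> V \<inter> F \<delta> \<noteq> {} \<and> (\<forall>y\<in>X T. proj \<delta> y \<in> V \<longrightarrow> y \<in> U)"
proof -
  define P where "P T \<longleftrightarrow> (\<forall>x U. x \<in> X T \<and> proj \<delta> x \<in> F \<delta> \<and> open U \<and> x \<in> U \<longrightarrow>
      (\<exists>V. open V \<and> V \<inter> F \<delta> \<noteq> {} \<and> (\<forall>y\<in>X T. proj \<delta> y \<in> V \<longrightarrow> y \<in> U)))" for T
  have step: "P T" if "T \<subseteq> S" and T: "\<And>\<beta> \<gamma>. \<beta> \<in> T \<Longrightarrow> \<gamma> < \<beta> \<Longrightarrow> \<gamma> \<in> T" and "{..<\<delta>} \<subseteq> T"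
    and IH: "\<And>\<beta>. \<beta> \<in> T \<Longrightarrow> \<delta> \<le> \<beta> \<Longrightarrow> P {..<\<beta>}" for T
    unfolding P_def
  proof (intro allI impI, elim conjE)
    fix x and U :: "(omega1 \<Rightarrow> real) set"
    assume x: "x \<in> X T" "proj \<delta> x \<in> F \<delta>" and "open U" "x \<in> U"
    then obtain I B where B: "finite I" "\<And>i. i \<in> I \<Longrightarrow> open (B i) \<and> x i \<in> B i"
        "{y. \<forall>i\<in>I. y i \<in> B i} \<subseteq> U"
      using open_contains_finite_box[OF \<open>open U\<close> \<open>x \<in> U\<close>] by blast
    define J where "J = I \<inter> T"
    have J: "y \<in> U" if "y \<in> X T" "\<And>i. i \<in> J \<Longrightarrow> y i \<in> B i" for y
    proof -
      have "y i \<in> B i" if "i \<in> I" for i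
      proof (cases "i \<in> T")
        case False
        then have "y i = x i"
          using lim_spaceD(1)[OF x(1)] lim_spaceD(1)[OF \<open>y \<in> X T\<close>] by (simp add: extensional_def)
        then show ?thesis using B(2)[OF \<open>i \<in> I\<close>] by simp
      qed (use that \<open>\<And>i. i \<in> J \<Longrightarrow> y i \<in> B i\<close> in \<open>auto simp: J_def\<close>)
      then show ?thesis using B(3) by blast
    qed
    have finJ: "finite J" using B(1) by (simp add: J_def)
    have openJ: "open {v. \<forall>i\<in>J'. v i \<in> B i}" if "J' \<subseteq> J" for J'
      by (rule product_topology_basis') (use B(2) finite_subset[OF that finJ] that in \<open>auto simp: J_def\<close>)
    show "\<exists>V. open V \<and> V \<inter> F \<delta> \<noteq> {} \<and> (\<forall>y\<in>X T. proj \<delta> y \<in> V \<longrightarrow> y \<in> U)"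
    proof (cases "J \<subseteq> {..<\<delta>}")
      case True
      let ?V = "{v. \<forall>i\<in>J. v i \<in> B i}"
      have *: "proj \<delta> y \<in> ?V \<longleftrightarrow> (\<forall>i\<in>J. y i \<in> B i)" for y
        using True by (auto simp: proj_apply subset_iff)
      then have "proj \<delta> x \<in> ?V" using B(2) by (simp add: J_def)
      then have "?V \<inter> F \<delta> \<noteq> {}" using x(2) by blast
      moreover have "y \<in> U" if "y \<in> X T" "proj \<delta> y \<in> ?V" for y
        using J[OF that(1)] that(2) unfolding * by simp
      ultimately show ?thesis using openJ[OF order_refl] by (intro exI[of _ ?V]) simp
    next
      case False
      \<comment> \<open>A basic neighbourhood restricts finitely many coordinates, so there is a
        largest one. The single step at \<beta> handles it, and the induction hypothesis for stage
        \<beta> handles the resulting open set \<open>W\<close>; thus limit lengths of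
        \<open>T\<close> are no special case.\<close>
      define \<beta> where "\<beta> = Max J"
      have "\<beta> \<in> J" "\<And>i. i \<in> J \<Longrightarrow> i \<le> \<beta>" using False finJ by (auto simp: \<beta>_def intro: Max_in)
      then have "\<beta> \<in> T" "\<delta> \<le> \<beta>"
        using False by (auto simp: J_def not_less subset_iff intro: order_trans)
      have sub: "{..<\<beta>} \<subseteq> T" using T \<open>\<beta> \<in> T\<close> by auto
      let ?U = "{v. \<forall>i\<in>J - {\<beta>}. v i \<in> B i} \<times> B \<beta>"
      have U_iff: "(proj \<beta> y, y \<beta>) \<in> ?U \<longleftrightarrow> (\<forall>i\<in>J. y i \<in> B i)" for y
        using \<open>\<beta> \<in> J\<close> \<open>\<And>i. i \<in> J \<Longrightarrow> i \<le> \<beta>\<close> by (auto simp: proj_apply order_less_le)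
      have U: "open ?U" using openJ[of "J - {\<beta>}"] B(2) \<open>\<beta> \<in> J\<close>
        by (auto intro!: open_Times simp: J_def)
      have xU: "(proj \<beta> x, x \<beta>) \<in> ?U" using U_iff B(2) by (auto simp: J_def)
      have xF: "proj \<delta> (proj \<beta> x) \<in> F \<delta>" using x(2) \<open>\<delta> \<le> \<beta>\<close> by (simp add: proj_proj)
      have ok: "split_ok K L F \<beta>" using split \<open>\<beta> \<in> T\<close> \<open>T \<subseteq> S\<close> by blast
      obtain W z where W: "open W" "z \<in> W" "z \<in> X {..<\<beta>}" "proj \<delta> z \<in> F \<delta>"
          "\<And>y s. y \<in> W \<Longrightarrow> (y, s) \<in> K \<beta> \<Longrightarrow> (y, s) \<in> ?U"
        using split_ok_irreducible[where K = K and \<alpha> = \<beta>, OF ok \<open>\<delta> \<le> \<beta>\<close> \<open>\<exists>\<gamma>. \<gamma> < \<delta>\<close>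
            lim_spaceD(2)[OF x(1) \<open>\<beta> \<in> T\<close>] xF U xU]
        by blast
      have "\<exists>V. open V \<and> V \<inter> F \<delta> \<noteq> {} \<and> (\<forall>y\<in>X {..<\<beta>}. proj \<delta> y \<in> V \<longrightarrow> y \<in> W)"
        using IH[OF \<open>\<beta> \<in> T\<close> \<open>\<delta> \<le> \<beta>\<close>, unfolded P_def, rule_format, of z W] W(1-4) by simp
      then obtain V where V: "open V" "V \<inter> F \<delta> \<noteq> {}"
          "\<And>y. y \<in> X {..<\<beta>} \<Longrightarrow> proj \<delta> y \<in> V \<Longrightarrow> y \<in> W"
        by blast
      have "y \<in> U" if y: "y \<in> X T" "proj \<delta> y \<in> V" for y
      proof -
        have "proj \<beta> y \<in> W"
          using V(3)[OF proj_in_lim_space[OF y(1) sub]] y(2) \<open>\<delta> \<le> \<beta>\<close> by (simp add: proj_proj)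
        then have "(proj \<beta> y, y \<beta>) \<in> ?U" using W(5) lim_spaceD(2)[OF y(1) \<open>\<beta> \<in> T\<close>] by blast
        then show ?thesis using U_iff J[OF y(1)] by blast
      qed
      then show ?thesis using V by blast
    qed
  qed
  have below: "P {..<\<beta>}" if "\<beta> \<in> S" "\<delta> \<le> \<beta>" for \<beta>
    using that
  proof (induction \<beta> rule: less_induct)
    case (less \<beta>)
    show ?case
    proof (rule step)
      show "{..<\<beta>} \<subseteq> S" using down less.prems(1) by blast
      show "{..<\<delta>} \<subseteq> {..<\<beta>}" using less.prems(2) by auto
      show "\<gamma> \<in> {..<\<beta>}" if "\<gamma>' \<in> {..<\<beta>}" "\<gamma> < \<gamma>'" for \<gamma> \<gamma>' using that by auto
      show "P {..<\<gamma>}" if "\<gamma> \<in> {..<\<beta>}" "\<delta> \<le> \<gamma>" for \<gamma>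
        using less.IH[of \<gamma>] that down[OF less.prems(1)] by simp
    qed
  qed
  have "P T"
  proof (rule step[OF assms(1) T assms(3)])
    show "P {..<\<beta>}" if "\<beta> \<in> T" "\<delta> \<le> \<beta>" for \<beta>
      using below that assms(1) by blast
  qed
  then show ?thesis using assms(5-8) unfolding P_def by simp
qed

end

section \<open>The recursion\<close>

text \<open>Locality for the recursion: a level can be judged before the splitting relation of its
  own stage exists.\<close>

lemma level_ok_cong:
  assumes "\<And>\<beta>. \<beta> < \<alpha> \<Longrightarrow> K \<beta> = K' \<beta>" "\<And>\<beta>. \<beta> \<le> \<alpha> \<Longrightarrow> L \<beta> = L' \<beta>" "F \<alpha> = F' \<alpha>"
  shows "level_ok K L F \<alpha> \<longleftrightarrow> level_ok K' L' F' \<alpha>"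
proof -
  have "lim_space K {..<\<alpha>} = lim_space K' {..<\<alpha>}" by (rule lim_space_cong) (simp add: assms(1))
  then show ?thesis using assms(2,3) by (simp add: level_ok_def)
qed

lemma split_ok_cong:
  assumes "\<And>\<beta>. \<beta> \<le> \<alpha> \<Longrightarrow> K \<beta> = K' \<beta>" "L \<alpha> = L' \<alpha>" "\<And>\<beta>. \<beta> \<le> \<alpha> \<Longrightarrow> F \<beta> = F' \<beta>"
  shows "split_ok K L F \<alpha> \<longleftrightarrow> split_ok K' L' F' \<alpha>"
proof -
  have "lim_space K {..<\<alpha>} = lim_space K' {..<\<alpha>}" by (rule lim_space_cong) (simp add: assms(1))
  then show ?thesis using assms by (simp add: split_ok_def)
qed

text \<open>An isolated point is the only point of \<open>F\<close> in some box on coordinates below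
  \<alpha>, and there are countably many such boxes.\<close>

lemma countable_isolated_points:
  fixes F :: "(omega1 \<Rightarrow> real) set"
  assumes "F \<subseteq> extensional {..<\<alpha>}"
  shows "countable {x \<in> F. \<not> x islimpt F}"
proof (rule countable_subset)
  let ?A = "lists ({..<\<alpha>} \<times> (UNIV :: (rat \<times> rat) set))"
  show "countable ((\<lambda>l. THE x. x \<in> open_box l \<inter> F) ` ?A)"
    using countable_lists_lessThan_omega1 by blast
  show "{x \<in> F. \<not> x islimpt F} \<subseteq> (\<lambda>l. THE x. x \<in> open_box l \<inter> F) ` ?A"
  proof
    fix x assume "x \<in> {x \<in> F. \<not> x islimpt F}"
    then obtain U where U: "x \<in> F" "open U" "x \<in> U" "\<And>y. y \<in> F \<Longrightarrow> y \<in> U \<Longrightarrow> y = x"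
      unfolding islimpt_def by blast
    then obtain l where l: "l \<in> ?A" "x \<in> open_box l" "closed_box l \<inter> extensional {..<\<alpha>} \<subseteq> U"
      using open_contains_box_extensional[of U x "{..<\<alpha>}"] assms by blast
    have "(THE y. y \<in> open_box l \<inter> F) = x"
    proof (rule the_equality)
      show "y = x" if "y \<in> open_box l \<inter> F" for y
        using that l(3) open_box_subset_closed_box assms U(4) by blast
    qed (use l(2) U(1) in blast)
    then show "x \<in> (\<lambda>l. THE x. x \<in> open_box l \<inter> F) ` ?A"
      by (intro image_eqI[OF _ l(1)]) simp
  qed
qed

context tower
begin

text \<open>By irreducibility a neighbourhood of \<open>x\<close> contains the full preimage of a
  nonempty relatively open part of \<open>F \<delta>\<close>. This part is not just
  \<open>{proj \<delta> x}\<close>, since points of \<open>L \<delta>\<close> are not isolated in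
  \<open>F \<delta>\<close>, so another point has a lift in the neighbourhood. Old guesses thereby
  remain suitable for oscillation at later stages.\<close>

lemma not_isolated:
  assumes "T \<subseteq> S" and T: "\<And>\<beta> \<gamma>. \<beta> \<in> T \<Longrightarrow> \<gamma> < \<beta> \<Longrightarrow> \<gamma> \<in> T" and "\<delta> \<in> S" "{..<\<delta>} \<subseteq> T" "\<exists>\<gamma>. \<gamma> < \<delta>"
    and "x \<in> X T" "proj \<delta> x \<in> F \<delta>" "proj \<delta> x \<in> L \<delta>"
  shows "x islimpt {y \<in> X T. proj \<delta> y \<in> F \<delta>}"
proof (rule islimptI)
  fix U assume "x \<in> U" "open U"
  have "\<exists>V. open V \<and> V \<inter> F \<delta> \<noteq> {} \<and> (\<forall>y\<in>X T. proj \<delta> y \<in> V \<longrightarrow> y \<in> U)"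
    by (rule irreducible[OF assms(1) T assms(4,5,6,7) \<open>open U\<close> \<open>x \<in> U\<close>])
  then obtain V where V: "open V" "V \<inter> F \<delta> \<noteq> {}" "\<And>y. y \<in> X T \<Longrightarrow> proj \<delta> y \<in> V \<Longrightarrow> y \<in> U"
    by blast
  have lim: "proj \<delta> x islimpt F \<delta>"
    using level_okD(6)[OF level[OF assms(3)]] assms(5,7,8) by blast
  have "\<exists>z\<in>V \<inter> F \<delta>. z \<noteq> proj \<delta> x"
  proof (rule ccontr)
    assume *: "\<not> ?thesis"
    then have "V \<inter> F \<delta> \<subseteq> {proj \<delta> x}" by blast
    then have "proj \<delta> x \<in> V" using V(2) by blast
    then show False using lim V(1) * unfolding islimpt_def by blast
  qed
  then obtain z where z: "z \<in> V" "z \<in> F \<delta>" "z \<noteq> proj \<delta> x" by blast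
  have "z \<in> X {..<\<delta>}" using z(2) F_sub[OF assms(3)] by blast
  then obtain y where "y \<in> X T" "restrict y {..<\<delta>} = z"
    using ex_extension[OF assms(4,1) T] by fastforce
  then have "y \<in> X T" "proj \<delta> y = z" by (auto simp: proj_def)
  then show "\<exists>y\<in>{y \<in> X T. proj \<delta> y \<in> F \<delta>}. y \<in> U \<and> y \<noteq> x" using V(3) z by blast
qed

lemma ex_higher_point:
  assumes "\<gamma> < \<delta>" "\<delta> \<in> S" "z \<in> L \<gamma>"
  shows "\<exists>z'\<in>L \<delta>. proj \<gamma> z' = z \<and> z' \<noteq> w"
  using level_okD(5)[OF level[OF assms(2)]] assms(1,3) by metis

lemma L_subset: "\<beta> \<in> S \<Longrightarrow> L \<beta> \<subseteq> X {..<\<beta>}"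
  using level_okD(3)[OF level] .

lemma L_proj: "\<beta> \<in> S \<Longrightarrow> x \<in> L \<beta> \<Longrightarrow> \<gamma> \<le> \<beta> \<Longrightarrow> proj \<gamma> x \<in> L \<gamma>"
  using level_okD(4)[OF level] L_subset lim_spaceD(1) proj_extensional_eq
  by (metis order_le_less subset_iff)

text \<open>
  Avoiding the countable set \<open>I\<close>: at a successor stage the fibre is uncountable, at a limit stage
  one diagonalises along a cofinal sequence, using that each point of \<open>L\<close> has two points above it.
\<close>

lemma ex_thread:
  assumes S: "S = {..<\<alpha>}" and "\<beta> < \<alpha>" "y \<in> L \<beta>" "countable I"
  shows "\<exists>x\<in>X S. proj \<beta> x = y \<and> (\<forall>\<delta><\<alpha>. proj \<delta> x \<in> L \<delta>) \<and> x \<notin> I"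
proof (cases "\<exists>\<delta><\<alpha>. \<forall>\<gamma><\<alpha>. \<gamma> \<le> \<delta>")
  case True
  then obtain \<delta> where \<delta>: "\<delta> < \<alpha>" "\<And>\<gamma>. \<gamma> < \<alpha> \<Longrightarrow> \<gamma> \<le> \<delta>" by blast
  have \<delta>S: "\<delta> \<in> S" using \<delta> S by simp
  have "\<exists>z\<in>L \<delta>. proj \<beta> z = y"
  proof (cases "\<beta> = \<delta>")
    case True
    then show ?thesis
      using assms(3) L_subset[OF \<delta>S] lim_spaceD(1) proj_extensional_eq by blast
  next
    case False
    then show ?thesis using ex_higher_point[OF _ \<delta>S assms(3)] \<delta>(2)[OF assms(2)] by fastforce
  qed
  then obtain z where z: "z \<in> L \<delta>" "proj \<beta> z = y" by blast
  then have zX: "z \<in> X {..<\<delta>}" using L_subset[OF \<delta>S] by blast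
  have "uncountable {t. (z, t) \<in> K \<delta>}" using split_okD(5)[OF split[OF \<delta>S]] z(1) by blast
  moreover have "countable ((\<lambda>x. x \<delta>) ` I)" using assms(4) by simp
  ultimately have "\<not> {t. (z, t) \<in> K \<delta>} \<subseteq> (\<lambda>x. x \<delta>) ` I" using countable_subset by blast
  then obtain t where t: "(z, t) \<in> K \<delta>" "t \<notin> (\<lambda>x. x \<delta>) ` I" by blast
  define x where "x = z(\<delta> := t)"
  have px: "proj \<gamma> x = proj \<gamma> z" if "\<gamma> \<le> \<delta>" for \<gamma>
    using that by (auto simp: x_def proj_eq_iff)
  have pz: "proj \<delta> x = z" using px[OF order_refl] proj_extensional_eq[OF lim_spaceD(1)[OF zX]] by simp
  have "(proj \<gamma> x, x \<gamma>) \<in> K \<gamma>" if "\<gamma> < \<alpha>" for \<gamma>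
  proof (cases "\<gamma> = \<delta>")
    case True
    then show ?thesis using t(1) pz by (simp add: x_def)
  next
    case False
    then have "\<gamma> < \<delta>" using \<delta>(2)[OF that] by simp
    then show ?thesis using lim_spaceD(2)[OF zX, of \<gamma>] px[of \<gamma>] False by (simp add: x_def)
  qed
  moreover have "x \<in> extensional {..<\<alpha>}"
    using lim_spaceD(1)[OF zX] \<delta>(1) by (auto simp: x_def extensional_def)
  ultimately have "x \<in> X S" by (simp add: lim_space_def S)
  moreover have "proj \<beta> x = y" using px \<delta>(2)[OF assms(2)] z(2) by simp
  moreover have "proj \<gamma> x \<in> L \<gamma>" if "\<gamma> < \<alpha>" for \<gamma>
    using px[OF \<delta>(2)[OF that]] L_proj[OF \<delta>S z(1) \<delta>(2)[OF that]] by simp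
  moreover have "x \<notin> I" using t(2) by (metis fun_upd_same image_eqI x_def)
  ultimately show ?thesis by blast
next
  case False
  then have lim: "\<exists>\<gamma><\<alpha>. \<delta> < \<gamma>" if "\<delta> < \<alpha>" for \<delta> using that by (meson not_le)
  define en where "en = from_nat_into {..<\<alpha>}"
  have en: "en n < \<alpha>" for n
    using from_nat_into[of "{..<\<alpha>}" n] assms(2) unfolding en_def by blast
  have en_surj: "\<exists>n. en n = \<xi>" if "\<xi> < \<alpha>" for \<xi>
    using from_nat_into_surj[OF countable_lessThan_omega1, of \<xi> \<alpha>] that by (auto simp: en_def)
  obtain i :: "nat \<Rightarrow> omega1 \<Rightarrow> real" where i: "I \<subseteq> range i"
    using subset_range_from_nat_into[OF assms(4)] by blast
  \<comment> \<open>\<open>p n\<close> consists of a level below \<alpha> and a point of it. Passing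
    above \<open>en n\<close> makes the levels cofinal in \<alpha>; staying off the projection of
    \<open>i n\<close> makes the final thread differ from \<open>i n\<close>.\<close>
  have "\<exists>p. \<forall>n. (fst (p n) < \<alpha> \<and> snd (p n) \<in> L (fst (p n)) \<and> (n = 0 \<longrightarrow> p n = (\<beta>, y))) \<and>
      (fst (p n) < fst (p (Suc n)) \<and> en n < fst (p (Suc n)) \<and> proj (fst (p n)) (snd (p (Suc n))) = snd (p n) \<and>
       snd (p (Suc n)) \<noteq> proj (fst (p (Suc n))) (i n))"
  proof (rule dependent_nat_choice)
    show "\<exists>p. fst p < \<alpha> \<and> snd p \<in> L (fst p) \<and> (0 = (0::nat) \<longrightarrow> p = (\<beta>, y))"
      using assms(2,3) by auto
    fix p :: "omega1 \<times> (omega1 \<Rightarrow> real)" and n :: nat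
    assume p: "fst p < \<alpha> \<and> snd p \<in> L (fst p) \<and> (n = 0 \<longrightarrow> p = (\<beta>, y))"
    then obtain \<gamma> where \<gamma>: "\<gamma> < \<alpha>" "max (fst p) (en n) < \<gamma>"
      using lim[of "max (fst p) (en n)"] en by auto
    then obtain z where "z \<in> L \<gamma>" "proj (fst p) z = snd p" "z \<noteq> proj \<gamma> (i n)"
      using ex_higher_point[of "fst p" \<gamma> "snd p"] p S by auto
    then show "\<exists>q. (fst q < \<alpha> \<and> snd q \<in> L (fst q) \<and> (Suc n = 0 \<longrightarrow> q = (\<beta>, y))) \<and>
        (fst p < fst q \<and> en n < fst q \<and> proj (fst p) (snd q) = snd p \<and> snd q \<noteq> proj (fst q) (i n))"
      using \<gamma> by (intro exI[of _ "(\<gamma>, z)"]) auto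
  qed
  then obtain p where p: "\<And>n. fst (p n) < \<alpha>" "\<And>n. snd (p n) \<in> L (fst (p n))" "p 0 = (\<beta>, y)"
      "\<And>n. fst (p n) < fst (p (Suc n))" "\<And>n. en n < fst (p (Suc n))"
      "\<And>n. proj (fst (p n)) (snd (p (Suc n))) = snd (p n)"
      "\<And>n. snd (p (Suc n)) \<noteq> proj (fst (p (Suc n))) (i n)" by blast
  define g where "g n = fst (p n)" for n
  define z where "z n = snd (p n)" for n
  have gS: "g n \<in> S" for n using p(1) S by (simp add: g_def)
  have zL: "z n \<in> L (g n)" for n using p(2) by (simp add: g_def z_def)
  have zX: "z n \<in> X {..<g n}" for n using zL L_subset[OF gS] by blast
  have z_step: "proj (g n) (z (Suc n)) = z n" for n using p(6) by (simp add: g_def z_def)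
  have gmono: "g m \<le> g n" if "m \<le> n" for m n
    using that p(4) lift_Suc_mono_le[of g] by (simp add: g_def less_imp_le)
  have coh: "proj (g m) (z n) = z m" if "m \<le> n" for m n
    using that
  proof (induction n rule: dec_induct)
    case base
    show ?case using proj_extensional_eq[OF lim_spaceD(1)[OF zX]] .
  next
    case (step n)
    then show ?case using z_step proj_proj[OF gmono[OF step(1)], of "z (Suc n)"] by simp
  qed
  have "\<exists>n. \<xi> < g n" if "\<xi> < \<alpha>" for \<xi> using en_surj[OF that] p(5) g_def by metis
  then obtain N where N: "\<And>\<xi>. \<xi> < \<alpha> \<Longrightarrow> \<xi> < g (N \<xi>)" by metis
  define x where "x \<xi> = (if \<xi> < \<alpha> then z (N \<xi>) \<xi> else undefined)" for \<xi>
  have xz: "proj (g n) x = z n" for n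
  proof -
    have "x \<xi> = z n \<xi>" if "\<xi> < g n" for \<xi>
    proof -
      have "\<xi> < \<alpha>" using that p(1)[of n] by (simp add: g_def)
      let ?m = "max n (N \<xi>)"
      have "z n \<xi> = z ?m \<xi>" using coh[of n ?m] that proj_apply by (metis max.cobounded1)
      moreover have "z (N \<xi>) \<xi> = z ?m \<xi>"
        using coh[of "N \<xi>" ?m] N[OF \<open>\<xi> < \<alpha>\<close>] proj_apply by (metis max.cobounded2)
      ultimately show ?thesis using \<open>\<xi> < \<alpha>\<close> by (simp add: x_def)
    qed
    then have "proj (g n) x = proj (g n) (z n)" by (simp add: proj_eq_iff)
    then show ?thesis using coh[OF order_refl] by simp
  qed
  have px: "proj \<delta> x = proj \<delta> (z n)" if "\<delta> \<le> g n" for \<delta> n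
    using proj_proj[OF that, of x] xz by simp
  have "(proj \<xi> x, x \<xi>) \<in> K \<xi>" if "\<xi> < \<alpha>" for \<xi>
    using lim_spaceD(2)[OF zX, of \<xi> "N \<xi>"] N[OF that] px[of \<xi> "N \<xi>"] that by (simp add: x_def)
  then have "x \<in> X S" by (auto simp: lim_space_def S extensional_def x_def)
  moreover have "proj \<beta> x = y" using xz[of 0] p(3) by (simp add: g_def z_def)
  moreover have "proj \<delta> x \<in> L \<delta>" if "\<delta> < \<alpha>" for \<delta>
    using px[of \<delta> "N \<delta>"] N[OF that] L_proj[OF gS zL, of \<delta> "N \<delta>"] by simp
  moreover have "x \<notin> I"
  proof
    assume "x \<in> I"
    then obtain n where "x = i n" using i by blast
    then show False using xz[of "Suc n"] p(7)[of n] by (simp add: g_def z_def)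
  qed
  ultimately show ?thesis by blast
qed

text \<open>Above each point of each earlier level two threads are placed, both avoiding the
  isolated points of \<open>F \<alpha>\<close>; the second is found by forbidding the first as well.
  Countably many countable levels give a countable new one.\<close>

lemma ex_level:
  assumes S: "S = {..<\<alpha>}" and F: "F \<alpha> \<subseteq> X {..<\<alpha>}"
  shows "\<exists>L0. level_ok K (L(\<alpha> := L0)) F \<alpha>"
proof (cases "\<exists>\<delta>. \<delta> < \<alpha>")
  case False
  then have *: "{..<\<alpha>} = {}" by auto
  have "X {..<\<alpha>} = {\<lambda>_. undefined}" unfolding lim_space_def * by auto
  then show ?thesis using False by (intro exI[of _ "{\<lambda>_. undefined}"]) (simp add: level_ok_def)
next
  case True
  define I where "I = {x \<in> F \<alpha>. \<not> x islimpt F \<alpha>}"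
  have "countable I"
    unfolding I_def using F lim_spaceD(1) by (intro countable_isolated_points[of _ \<alpha>]) blast
  define Q where "Q \<beta> y u \<longleftrightarrow> u \<in> X {..<\<alpha>} \<and> proj \<beta> u = y \<and> (\<forall>\<delta><\<alpha>. proj \<delta> u \<in> L \<delta>) \<and> u \<notin> I"
    for \<beta> y u
  have "\<exists>x x'. x \<noteq> x' \<and> Q \<beta> y x \<and> Q \<beta> y x'"
    if \<beta>: "\<beta> < \<alpha>" "y \<in> L \<beta>" for \<beta> y
  proof -
    obtain x where x: "x \<in> X S" "proj \<beta> x = y" "\<forall>\<delta><\<alpha>. proj \<delta> x \<in> L \<delta>" "x \<notin> I"
      using ex_thread[OF S \<beta> \<open>countable I\<close>] by blast
    obtain x' where "x' \<in> X S" "proj \<beta> x' = y" "\<forall>\<delta><\<alpha>. proj \<delta> x' \<in> L \<delta>" "x' \<notin> insert x I"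
      using ex_thread[OF S \<beta>, of "insert x I"] \<open>countable I\<close> by blast
    then show ?thesis using x S by (intro exI[of _ x] exI[of _ x']) (auto simp: Q_def)
  qed
  then obtain u v where
    uv: "\<And>\<beta> y. \<beta> < \<alpha> \<Longrightarrow> y \<in> L \<beta> \<Longrightarrow> u \<beta> y \<noteq> v \<beta> y \<and> Q \<beta> y (u \<beta> y) \<and> Q \<beta> y (v \<beta> y)"
    by metis
  then have Q: "Q \<beta> y x" if "\<beta> < \<alpha>" "y \<in> L \<beta>" "x \<in> {u \<beta> y, v \<beta> y}" for \<beta> y x
    using that by blast
  define L0 where "L0 = (\<Union>\<beta>\<in>{..<\<alpha>}. \<Union>y\<in>L \<beta>. {u \<beta> y, v \<beta> y})"
  have L0: "x \<in> L0 \<longleftrightarrow> (\<exists>\<beta><\<alpha>. \<exists>y\<in>L \<beta>. x \<in> {u \<beta> y, v \<beta> y})" for x by (auto simp: L0_def)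
  have Q0: "\<exists>\<beta> y. Q \<beta> y x" if "x \<in> L0" for x using that L0 Q by blast
  have "level_ok K (L(\<alpha> := L0)) F \<alpha>"
    unfolding level_ok_def fun_upd_same
  proof (intro conjI)
    have "countable (L \<beta>)" if "\<beta> < \<alpha>" for \<beta> using level_okD(1)[OF level] that S by blast
    then show "countable L0"
      unfolding L0_def by (intro countable_UN countable_lessThan_omega1) auto
    obtain \<delta> where "\<delta> < \<alpha>" using True by blast
    then obtain y where "y \<in> L \<delta>" using level_okD(2)[OF level] S by blast
    then show "L0 \<noteq> {}" using L0 \<open>\<delta> < \<alpha>\<close> by blast
    show "L0 \<subseteq> X {..<\<alpha>}" using Q0 unfolding Q_def by blast
    show "\<forall>x\<in>L0. \<forall>\<beta><\<alpha>. proj \<beta> x \<in> (L(\<alpha> := L0)) \<beta>"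
      using Q0 unfolding Q_def by fastforce
    show "\<forall>\<beta><\<alpha>. \<forall>y\<in>(L(\<alpha> := L0)) \<beta>. \<exists>x\<in>L0. \<exists>x'\<in>L0. x \<noteq> x' \<and> proj \<beta> x = y \<and> proj \<beta> x' = y"
    proof (intro allI impI ballI)
      fix \<beta> y assume "\<beta> < \<alpha>" "y \<in> (L(\<alpha> := L0)) \<beta>"
      then have "\<beta> < \<alpha>" "y \<in> L \<beta>" by (auto split: if_splits)
      then show "\<exists>x\<in>L0. \<exists>x'\<in>L0. x \<noteq> x' \<and> proj \<beta> x = y \<and> proj \<beta> x' = y"
      proof (intro bexI conjI)
        show "u \<beta> y \<in> L0" "v \<beta> y \<in> L0" using L0 \<open>\<beta> < \<alpha>\<close> \<open>y \<in> L \<beta>\<close> by blast+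
      qed (use uv[OF \<open>\<beta> < \<alpha>\<close> \<open>y \<in> L \<beta>\<close>] in \<open>auto simp: Q_def\<close>)
    qed
    show "(\<exists>\<delta>. \<delta> < \<alpha>) \<longrightarrow> (\<forall>x\<in>L0 \<inter> F \<alpha>. x islimpt F \<alpha>)"
      using Q0 unfolding Q_def I_def by blast
  qed
  then show ?thesis by blast
qed

text \<open>The family to be respected consists of the preimages of all guesses so far, countably
  many because \<alpha> is countable. Points of \<open>L0\<close> are limits of those members that
  contain them: for the current guess by the choice of the level, for older ones by
  \<open>not_isolated\<close>.\<close>

lemma ex_split:
  assumes S: "S = {..<\<alpha>}" and F: "F \<alpha> \<subseteq> X {..<\<alpha>}" and L0: "level_ok K (L(\<alpha> := L0)) F \<alpha>"
  shows "\<exists>K0. split_ok (K(\<alpha> := K0)) (L(\<alpha> := L0)) F \<alpha>"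
proof -
  let ?X = "X {..<\<alpha>}"
  define \<F> where "\<F> = (\<lambda>\<delta>. {y \<in> ?X. proj \<delta> y \<in> F \<delta>}) ` {\<delta>. \<delta> \<le> \<alpha> \<and> (\<exists>\<gamma>. \<gamma> < \<delta>)}"
  have "{\<delta>. \<delta> \<le> \<alpha> \<and> (\<exists>\<gamma>. \<gamma> < \<delta>)} \<subseteq> insert \<alpha> {..<\<alpha>}" by auto
  then have "countable {\<delta>. \<delta> \<le> \<alpha> \<and> (\<exists>\<gamma>. \<gamma> < \<delta>)}"
    using countable_subset countable_lessThan_omega1 countable_insert by metis
  then have "countable \<F>" unfolding \<F>_def by (rule countable_image)
  have L0X: "L0 \<subseteq> ?X" "countable L0" using level_okD(1,3)[OF L0] by auto
  have g: "\<exists>g. continuous_on ?X g \<and> (\<forall>y\<in>?X. 0 \<le> g y \<and> (g y = (0::real) \<longleftrightarrow> y = x))" if "x \<in> L0" for x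
  proof -
    have ext: "y = x \<longleftrightarrow> (\<forall>\<xi><\<alpha>. y \<xi> = x \<xi>)" if "y \<in> ?X" for y
    proof -
      have "x \<in> ?X" using \<open>x \<in> L0\<close> L0X by blast
      then show ?thesis
        using lim_spaceD(1)[OF that] lim_spaceD(1)[of x K "{..<\<alpha>}"]
        by (auto simp: extensional_def fun_eq_iff) metis
    qed
    show ?thesis
    proof (cases "\<exists>\<delta>. \<delta> < \<alpha>")
      case False
      then show ?thesis using ext by (intro exI[of _ "\<lambda>_. 0"]) auto
    next
      case True
      \<comment> \<open>Enumerating the countably many coordinates embeds the stage in
        \<open>nat \<Rightarrow> real\<close>, whose metric yields a continuous function vanishing
        only at \<open>x\<close>. The enumeration needs a coordinate, hence the separate case
        \<alpha> = 0.\<close>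
      define \<Theta> where "\<Theta> y n = y (from_nat_into {..<\<alpha>} n)" for y :: "omega1 \<Rightarrow> real" and n
      have "\<Theta> y = \<Theta> x \<longleftrightarrow> (\<forall>\<xi><\<alpha>. y \<xi> = x \<xi>)" for y
      proof
        assume *: "\<Theta> y = \<Theta> x"
        show "\<forall>\<xi><\<alpha>. y \<xi> = x \<xi>"
        proof (intro allI impI)
          fix \<xi> assume "\<xi> < \<alpha>"
          then obtain n where "from_nat_into {..<\<alpha>} n = \<xi>"
            using from_nat_into_surj[OF countable_lessThan_omega1, of \<xi> \<alpha>] by auto
          then show "y \<xi> = x \<xi>" using fun_cong[OF *, of n] by (simp add: \<Theta>_def)
        qed
      next
        assume "\<forall>\<xi><\<alpha>. y \<xi> = x \<xi>"
        moreover have "from_nat_into {..<\<alpha>} n < \<alpha>" for n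
          using from_nat_into[of "{..<\<alpha>}" n] True by auto
        ultimately show "\<Theta> y = \<Theta> x" by (auto simp: \<Theta>_def)
      qed
      then have "(dist (\<Theta> y) (\<Theta> x) = 0) = (y = x)" if "y \<in> ?X" for y
        using ext[OF that] by simp
      moreover have "continuous_on ?X (\<lambda>y. \<Theta> y n)" for n
        unfolding \<Theta>_def by (rule continuous_on_subset[OF continuous_on_product_coordinates]) simp
      then have "continuous_on ?X \<Theta>" by (rule continuous_on_coordinatewise_then_product)
      then have "continuous_on ?X (\<lambda>y. dist (\<Theta> y) (\<Theta> x))"
        by (intro continuous_on_dist continuous_on_const)
      ultimately show ?thesis by (intro exI[of _ "\<lambda>y. dist (\<Theta> y) (\<Theta> x)"]) auto
    qed
  qed
  have lim: "x islimpt A" if "A \<in> \<F>" "x \<in> L0" "x \<in> A" for A x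
  proof -
    obtain \<delta> where \<delta>: "\<delta> \<le> \<alpha>" "\<exists>\<gamma>. \<gamma> < \<delta>" "A = {y \<in> ?X. proj \<delta> y \<in> F \<delta>}"
      using \<open>A \<in> \<F>\<close> by (auto simp: \<F>_def)
    show ?thesis
    proof (cases "\<delta> = \<alpha>")
      case True
      have "proj \<alpha> y = y" if "y \<in> ?X" for y using that lim_spaceD(1) proj_extensional_eq by blast
      then have "A = F \<alpha>" using \<delta>(3) True F by auto
      then show ?thesis using level_okD(6)[OF L0] that \<delta> True by auto
    next
      case False
      then have "\<delta> < \<alpha>" using \<delta>(1) by simp
      moreover have "proj \<delta> x \<in> (L(\<alpha> := L0)) \<delta>"
        using level_okD(4)[OF L0] \<open>x \<in> L0\<close> \<open>\<delta> < \<alpha>\<close> by simp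
      ultimately have "proj \<delta> x \<in> L \<delta>" by (simp split: if_splits)
      then show ?thesis
        unfolding \<delta>(3)
        by (intro not_isolated) (use that \<delta> \<open>\<delta> < \<alpha>\<close> S in auto)
    qed
  qed
  have sub: "A \<subseteq> ?X" if "A \<in> \<F>" for A using that by (auto simp: \<F>_def)
  have cX: "compact ?X" using compact_lim_space S by simp
  show ?thesis
  proof (rule ex_irreducible_splitting[OF Hausdorff_space_euclidean_fun cX L0X(2,1) g \<open>countable \<F>\<close> sub lim])
    fix K0 :: "((omega1 \<Rightarrow> real) \<times> real) set"
    assume K0: "closed K0" "K0 \<subseteq> ?X \<times> {0..1}" "\<And>x. x \<in> ?X \<Longrightarrow> \<exists>t. (x, t) \<in> K0"
      "\<And>x t s. x \<notin> L0 \<Longrightarrow> (x, t) \<in> K0 \<Longrightarrow> (x, s) \<in> K0 \<Longrightarrow> t = s"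
      "\<And>x. x \<in> L0 \<Longrightarrow> uncountable {t. (x, t) \<in> K0}"
      and irr: "\<And>A x t U. A \<in> \<F> \<Longrightarrow> x \<in> A \<Longrightarrow> (x, t) \<in> K0 \<Longrightarrow> open U \<Longrightarrow> (x, t) \<in> U \<Longrightarrow>
         \<exists>W. open W \<and> W \<inter> A \<noteq> {} \<and> (\<forall>y\<in>W. \<forall>s. (y, s) \<in> K0 \<longrightarrow> (y, s) \<in> U)"
    have eqX: "lim_space (K(\<alpha> := K0)) {..<\<alpha>} = ?X" by (rule lim_space_cong) auto
    have "split_ok (K(\<alpha> := K0)) (L(\<alpha> := L0)) F \<alpha>"
      unfolding split_ok_def fun_upd_same eqX
    proof (intro conjI allI impI ballI)
      fix \<delta> x t U
      assume \<delta>: "\<delta> \<le> \<alpha>" "\<exists>\<gamma>. \<gamma> < \<delta>" and *: "(x, t) \<in> K0 \<and> proj \<delta> x \<in> F \<delta> \<and> open U \<and> (x, t) \<in> U"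
      let ?A = "{y \<in> ?X. proj \<delta> y \<in> F \<delta>}"
      have "?A \<in> \<F>" using \<delta> by (auto simp: \<F>_def)
      moreover have "x \<in> ?A" using * K0(2) by blast
      ultimately obtain W where "open W" "W \<inter> ?A \<noteq> {}" "\<forall>y\<in>W. \<forall>s. (y, s) \<in> K0 \<longrightarrow> (y, s) \<in> U"
        using irr * by meson
      then show "\<exists>W. open W \<and> (\<exists>y\<in>W. y \<in> ?X \<and> proj \<delta> y \<in> F \<delta>) \<and> (\<forall>y\<in>W. \<forall>s. (y, s) \<in> K0 \<longrightarrow> (y, s) \<in> U)"
        by blast
    qed (use K0 in blast)+
    then show ?thesis by blast
  qed
qed

end

text \<open>The guess takes \<open>K\<close> as an argument because it lives in a space that is only
  being built; \<open>cong\<close> prevents circularity.\<close>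

lemma ex_tower:
  fixes G :: "(omega1 \<Rightarrow> ((omega1 \<Rightarrow> real) \<times> real) set) \<Rightarrow> omega1 \<Rightarrow> (omega1 \<Rightarrow> real) set"
  assumes sub: "\<And>K \<alpha>. G K \<alpha> \<subseteq> lim_space K {..<\<alpha>}"
    and cong: "\<And>K K' \<alpha>. (\<And>\<beta>. \<beta> < \<alpha> \<Longrightarrow> K \<beta> = K' \<beta>) \<Longrightarrow> G K \<alpha> = G K' \<alpha>"
  shows "\<exists>K L. tower K L (G K) UNIV"
proof -
  define k where "k f \<beta> = fst (f \<beta>)"
    for f :: "omega1 \<Rightarrow> ((omega1 \<Rightarrow> real) \<times> real) set \<times> (omega1 \<Rightarrow> real) set" and \<beta>
  define l where "l f \<beta> = snd (f \<beta>)"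
    for f :: "omega1 \<Rightarrow> ((omega1 \<Rightarrow> real) \<times> real) set \<times> (omega1 \<Rightarrow> real) set" and \<beta>
  define ok where "ok f \<alpha> \<longleftrightarrow> level_ok (k f) (l f) (G (k f)) \<alpha> \<and> split_ok (k f) (l f) (G (k f)) \<alpha>" for f \<alpha>
  \<comment> \<open>Values beyond \<alpha> are filler. Truncation turns a condition on a whole
    function into one on its earlier values and a candidate \<open>r\<close>, the form required by
    well-founded choice.\<close>
  define cut where "cut f \<alpha> r = (\<lambda>\<beta>. if \<beta> < \<alpha> then f \<beta> else r)"
    for f :: "omega1 \<Rightarrow> ((omega1 \<Rightarrow> real) \<times> real) set \<times> (omega1 \<Rightarrow> real) set" and \<alpha> r
  have ok_cong: "ok f \<alpha> \<longleftrightarrow> level_ok K L F \<alpha> \<and> split_ok K L F \<alpha>"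
    if "\<And>\<beta>. \<beta> \<le> \<alpha> \<Longrightarrow> k f \<beta> = K \<beta>" "\<And>\<beta>. \<beta> \<le> \<alpha> \<Longrightarrow> l f \<beta> = L \<beta>" "\<And>\<beta>. \<beta> \<le> \<alpha> \<Longrightarrow> G (k f) \<beta> = F \<beta>"
    for f \<alpha> K L F
    unfolding ok_def using that
    by (intro arg_cong2[of _ _ _ _ "(\<and>)"] level_ok_cong split_ok_cong) auto
  have ok_cut: "ok (cut f \<alpha> (f \<alpha>)) \<alpha> \<longleftrightarrow> ok f \<alpha>" for f \<alpha>
    unfolding ok_def[of f]
  proof (rule ok_cong)
    show k: "k (cut f \<alpha> (f \<alpha>)) \<beta> = k f \<beta>" "l (cut f \<alpha> (f \<alpha>)) \<beta> = l f \<beta>" if "\<beta> \<le> \<alpha>" for \<beta>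
      using that by (auto simp: k_def l_def cut_def)
    show "G (k (cut f \<alpha> (f \<alpha>))) \<beta> = G (k f) \<beta>" if "\<beta> \<le> \<alpha>" for \<beta>
      by (rule cong) (use k that in auto)
  qed
  have "\<exists>f. \<forall>\<alpha>. ok (cut f \<alpha> (f \<alpha>)) \<alpha>"
  proof (rule dependent_wellorder_choice)
    show "ok (cut f \<alpha> r) \<alpha> = ok (cut g \<alpha> r) \<alpha>" if "\<And>\<beta>. \<beta> < \<alpha> \<Longrightarrow> f \<beta> = g \<beta>" for r f g \<alpha>
      using that by (intro arg_cong2[of _ _ _ _ ok] refl) (auto simp: cut_def)
    fix \<alpha> f assume "\<And>\<beta>. \<beta> < \<alpha> \<Longrightarrow> ok (cut f \<beta> (f \<beta>)) \<beta>"
    then have IH: "\<And>\<beta>. \<beta> < \<alpha> \<Longrightarrow> ok f \<beta>" by (simp add: ok_cut)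
    then interpret tower "k f" "l f" "G (k f)" "{..<\<alpha>}"
      using sub by unfold_locales (auto simp: ok_def)
    obtain L0 where L0: "level_ok (k f) ((l f)(\<alpha> := L0)) (G (k f)) \<alpha>"
      using ex_level[OF refl sub] by blast
    then obtain K0 where K0: "split_ok ((k f)(\<alpha> := K0)) ((l f)(\<alpha> := L0)) (G (k f)) \<alpha>"
      using ex_split[OF refl sub] by blast
    have cutk: "k (cut f \<alpha> (K0, L0)) \<beta> = ((k f)(\<alpha> := K0)) \<beta>"
      and cutl: "l (cut f \<alpha> (K0, L0)) \<beta> = ((l f)(\<alpha> := L0)) \<beta>" if "\<beta> \<le> \<alpha>" for \<beta>
      using that by (auto simp: k_def l_def cut_def)
    have "level_ok ((k f)(\<alpha> := K0)) ((l f)(\<alpha> := L0)) (G (k f)) \<alpha>"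
      using L0 by (subst level_ok_cong[where K' = "k f" and L' = "(l f)(\<alpha> := L0)" and F' = "G (k f)"]) auto
    moreover have "G (k (cut f \<alpha> (K0, L0))) \<beta> = G (k f) \<beta>" if "\<beta> \<le> \<alpha>" for \<beta>
      by (rule cong) (use cutk that in auto)
    ultimately have "ok (cut f \<alpha> (K0, L0)) \<alpha>"
      using ok_cong[OF cutk cutl] K0 by blast
    then show "\<exists>r. ok (cut f \<alpha> r) \<alpha>" by blast
  qed
  then obtain f where "\<And>\<alpha>. ok f \<alpha>" unfolding ok_cut by blast
  then have "tower (k f) (l f) (G (k f)) UNIV"
    using sub by unfold_locales (auto simp: ok_def)
  then show ?thesis by blast
qed

section \<open>The limit space\<close>

lemma proj_in_open_box_iff:
  "l \<in> lists ({..<\<alpha>} \<times> UNIV) \<Longrightarrow> proj \<alpha> y \<in> open_box l \<longleftrightarrow> y \<in> open_box l"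
  by (force simp: open_box_def in_lists_conv_set proj_def)

lemma proj_in_closed_box_iff:
  "l \<in> lists ({..<\<alpha>} \<times> UNIV) \<Longrightarrow> proj \<alpha> y \<in> closed_box l \<longleftrightarrow> y \<in> closed_box l"
  by (force simp: closed_box_def in_lists_conv_set proj_def)

lemma proj_extensional: "proj \<alpha> y \<in> extensional {..<\<alpha>}"
  by (simp add: proj_def)

lemma cube_eq: "cube = top_of_set (PiE UNIV (\<lambda>_. {0..1}))"
  unfolding cube_def
  using subtopology_product_topology[of "\<lambda>_. euclideanreal" "UNIV :: omega1 set" "\<lambda>_. {0..1}"]
  by (simp add: euclidean_product_topology)

lemma subtopology_cube:
  assumes "Z \<subseteq> PiE UNIV (\<lambda>_. {0..1})"
  shows "subtopology cube Z = top_of_set Z"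
  unfolding cube_eq subtopology_subtopology Int_absorb1[OF assms] ..

text \<open>This isolates what diamond contributes to the limit space. Asking that even the closed
  boxes miss \<open>H\<close> exhausts the complement of \<open>H\<close> by countably many compact
  pieces.\<close>

locale determined_tower = tower K L F UNIV for K L F +
  assumes determined: "closed H \<Longrightarrow> H \<subseteq> lim_space K UNIV \<Longrightarrow>
    \<exists>\<alpha> C. (\<exists>\<gamma>. \<gamma> < \<alpha>) \<and> (\<forall>x\<in>lim_space K UNIV. x \<in> H \<longleftrightarrow> proj \<alpha> x \<in> F \<alpha>) \<and> countable C \<and>
      lim_space K UNIV - H \<subseteq> (\<Union>l\<in>C. open_box l) \<and> H \<inter> (\<Union>l\<in>C. closed_box l) = {}"
begin

abbreviation Z :: "(omega1 \<Rightarrow> real) set"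
  where "Z \<equiv> lim_space K UNIV"

lemma compact_Z: "compact Z" and closed_Z: "closed Z"
  using compact_lim_space compact_imp_closed_Hausdorff[OF Hausdorff_space_euclidean_fun] by auto

lemma Z_range: "Z \<subseteq> PiE UNIV (\<lambda>_. {0..1})"
  using lim_space_range[of _ UNIV] by (auto simp: PiE_iff)

text \<open>The part of \<open>Z\<close> covered by the ambient open sets is the complement of a
  closed set, hence \<sigma>-compact by \<open>determined\<close>. Finitely many members of the
  cover suffice for each compact piece.\<close>

lemma hereditarily_Lindelof_Z: "hereditarily Lindelof_space (top_of_set Z)"
proof -
  have "Lindelof_space (top_of_set S)" if "S \<subseteq> Z" for S
    unfolding Lindelof_space_def
  proof (intro allI impI, elim conjE)
    fix \<U> assume \<U>: "\<forall>U\<in>\<U>. openin (top_of_set S) U" "\<Union>\<U> = topspace (top_of_set S)"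
    then obtain W where W: "\<And>U. U \<in> \<U> \<Longrightarrow> open (W U) \<and> U = S \<inter> W U"
      unfolding openin_open by metis
    define H where "H = Z - (\<Union>U\<in>\<U>. W U)"
    have "closed H" unfolding H_def using W closed_Z by (intro closed_Diff open_UN) auto
    moreover have "H \<subseteq> Z" by (auto simp: H_def)
    ultimately obtain C where C: "countable C" "Z - H \<subseteq> (\<Union>l\<in>C. open_box l)"
        "H \<inter> (\<Union>l\<in>C. closed_box l) = {}"
      using determined by meson
    have "\<exists>\<V>\<subseteq>\<U>. finite \<V> \<and> Z \<inter> closed_box l \<subseteq> (\<Union>U\<in>\<V>. W U)" if "l \<in> C" for l
    proof -
      have "compact (Z \<inter> closed_box l)" using compact_Z closed_closed_box by (rule compact_Int_closed)
      moreover have "Z \<inter> closed_box l \<subseteq> (\<Union>U\<in>\<U>. W U)" using C(3) that by (auto simp: H_def)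
      ultimately show ?thesis using W by (elim compactE_image) auto
    qed
    then obtain \<V> where \<V>: "\<And>l. l \<in> C \<Longrightarrow> \<V> l \<subseteq> \<U> \<and> finite (\<V> l) \<and> Z \<inter> closed_box l \<subseteq> (\<Union>U\<in>\<V> l. W U)"
      by metis
    define \<W> where "\<W> = (\<Union>l\<in>C. \<V> l)"
    have "countable \<W>" unfolding \<W>_def using C(1) \<V> by (intro countable_UN) (auto intro: countable_finite)
    moreover have "\<W> \<subseteq> \<U>" using \<V> by (auto simp: \<W>_def)
    moreover have "S \<subseteq> \<Union>\<W>"
    proof
      fix s assume "s \<in> S"
      then have "s \<in> Z - H" using that \<U>(2) W by (auto simp: H_def)
      then obtain l where l: "l \<in> C" "s \<in> closed_box l" using C(2) open_box_subset_closed_box by blast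
      then obtain U where "U \<in> \<V> l" "s \<in> W U" using \<V> \<open>s \<in> Z - H\<close> by blast
      then show "s \<in> \<Union>\<W>" using \<V>[OF l(1)] W[of U] \<open>s \<in> S\<close> l(1) by (auto simp: \<W>_def)
    qed
    ultimately show "\<exists>\<V>. countable \<V> \<and> \<V> \<subseteq> \<U> \<and> \<Union>\<V> = topspace (top_of_set S)"
      using \<U>(2) by (intro exI[of _ \<W>]) auto
  qed
  then show ?thesis by (simp add: hereditarily_def subtopology_subtopology Int_absorb1)
qed

text \<open>With \<alpha> determining the closure of \<open>S\<close>, one point of \<open>S\<close>
  is picked from each box on coordinates below \<alpha> that meets \<open>S\<close>. These boxes are
  no base of \<open>Z\<close>, but by irreducibility every neighbourhood of a point of
  \<open>S\<close> contains the full preimage of a piece of \<open>F \<alpha>\<close>, and such a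
  piece contains the trace of a box.\<close>

lemma hereditarily_separable_Z: "hereditarily separable_space (top_of_set Z)"
proof -
  have "separable_space (top_of_set S)" if "S \<subseteq> Z" for S
  proof -
    define H where "H = closure S"
    have "closed H" "H \<subseteq> Z" "S \<subseteq> H"
      using closure_minimal[OF that closed_Z] closure_subset[of S] by (simp_all add: H_def)
    then obtain \<alpha> where \<alpha>: "\<exists>\<gamma>. \<gamma> < \<alpha>" "\<And>x. x \<in> Z \<Longrightarrow> x \<in> H \<longleftrightarrow> proj \<alpha> x \<in> F \<alpha>"
      using determined by meson
    let ?A = "{l \<in> lists ({..<\<alpha>} \<times> UNIV). S \<inter> open_box l \<noteq> {}}"
    define s where "s l = (SOME s. s \<in> S \<inter> open_box l)" for l
    have s: "s l \<in> S \<inter> open_box l" if "l \<in> ?A" for l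
      unfolding s_def by (rule someI_ex[of "\<lambda>s. s \<in> S \<inter> open_box l"]) (use that in blast)
    have "countable ?A" using countable_lists_lessThan_omega1 by (rule countable_subset[rotated]) auto
    then have "countable (s ` ?A)" by simp
    moreover have "s ` ?A \<subseteq> S" using s by blast
    moreover have "S \<subseteq> closure (s ` ?A)"
    proof (rule subsetI, unfold closure_iff_nhds_not_empty, intro allI impI)
      fix x U' U assume "x \<in> S" and U: "U \<subseteq> U'" "open U" "x \<in> U"
      have x: "x \<in> Z" "proj \<alpha> x \<in> F \<alpha>" using \<open>x \<in> S\<close> \<open>S \<subseteq> H\<close> \<open>S \<subseteq> Z\<close> \<alpha>(2) by blast+
      have "\<exists>V. open V \<and> V \<inter> F \<alpha> \<noteq> {} \<and> (\<forall>y\<in>Z. proj \<alpha> y \<in> V \<longrightarrow> y \<in> U)"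
        by (rule irreducible) (use \<alpha>(1) x U in auto)
      then obtain V z where V: "open V" "z \<in> V" "z \<in> F \<alpha>" "\<And>y. y \<in> Z \<Longrightarrow> proj \<alpha> y \<in> V \<Longrightarrow> y \<in> U"
        by blast
      have zX: "z \<in> X {..<\<alpha>}" using F_sub V(3) by blast
      obtain l where l: "l \<in> lists ({..<\<alpha>} \<times> UNIV)" "z \<in> open_box l"
          "closed_box l \<inter> extensional {..<\<alpha>} \<subseteq> V"
        using open_contains_box_extensional[OF V(1,2) lim_spaceD(1)[OF zX]] .
      have "\<exists>y\<in>Z. restrict y {..<\<alpha>} = z" by (rule ex_extension) (use zX in auto)
      then obtain y where y: "y \<in> Z" "proj \<alpha> y = z" unfolding proj_def by blast
      \<comment> \<open>The lift \<open>y\<close> need not be in \<open>S\<close>, but it is in the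
        closure of \<open>S\<close>, so the open box around it meets \<open>S\<close>.\<close>
      then have "y \<in> H" "y \<in> open_box l"
        using \<alpha>(2) V(3) l(2) proj_in_open_box_iff[OF l(1), of y] by auto
      then have "open_box l \<inter> S \<noteq> {}"
        using open_open_box[of l] open_Int_closure_eq_empty[of "open_box l" S] by (auto simp: H_def)
      then have lA: "l \<in> ?A" using l(1) by blast
      then have sl: "s l \<in> S" "s l \<in> open_box l" using s by blast+
      then have "proj \<alpha> (s l) \<in> closed_box l"
        using proj_in_open_box_iff[OF l(1)] open_box_subset_closed_box by blast
      then have "proj \<alpha> (s l) \<in> V" using l(3) proj_extensional by blast
      then have "s l \<in> U" using V(4) sl(1) \<open>S \<subseteq> Z\<close> by blast
      then show "s ` ?A \<inter> U' \<noteq> {}" using lA U(1) by blast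
    qed
    ultimately have "top_of_set S closure_of (s ` ?A) = topspace (top_of_set S)"
      by (simp add: closure_of_subtopology Int_absorb1 Int_absorb2)
    then show ?thesis
      unfolding separable_space_def using \<open>countable (s ` ?A)\<close> \<open>s ` ?A \<subseteq> S\<close>
      by (intro exI[of _ "s ` ?A"]) auto
  qed
  then show ?thesis by (simp add: hereditarily_def subtopology_subtopology Int_absorb1)
qed

text \<open>A G-delta point of a compact Hausdorff space has a countable local base: here the
  complements of finite unions of closed boxes that miss the point.\<close>

lemma first_countable_Z: "first_countable (top_of_set Z)"
  unfolding first_countable_def
proof
  fix x assume "x \<in> topspace (top_of_set Z)"
  then have x: "x \<in> Z" by simp
  have "closed {x}" by (rule compact_imp_closed_Hausdorff[OF Hausdorff_space_euclidean_fun]) simp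
  then obtain C where C: "countable C" "Z - {x} \<subseteq> (\<Union>l\<in>C. open_box l)"
      "{x} \<inter> (\<Union>l\<in>C. closed_box l) = {}"
    using determined[of "{x}"] x by (metis empty_subsetI insert_subset)
  define \<B> where "\<B> = (\<lambda>D. Z - (\<Union>l\<in>D. closed_box l)) ` {D. finite D \<and> D \<subseteq> C}"
  have "countable \<B>" unfolding \<B>_def using countable_Collect_finite_subset[OF C(1)] by blast
  moreover have "openin (top_of_set Z) V" if V: "V \<in> \<B>" for V
  proof -
    obtain D where D: "finite D" "V = Z - (\<Union>l\<in>D. closed_box l)"
      using V unfolding \<B>_def by blast
    then have "V = Z \<inter> - (\<Union>l\<in>D. closed_box l)" by blast
    moreover have "open (- (\<Union>l\<in>D. closed_box l))"
      using D(1) closed_closed_box by (intro open_Compl closed_UN) auto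
    ultimately show ?thesis unfolding openin_open by blast
  qed
  moreover have "\<exists>V\<in>\<B>. x \<in> V \<and> V \<subseteq> U" if "openin (top_of_set Z) U" "x \<in> U" for U
  proof -
    obtain O' where O: "open O'" "U = Z \<inter> O'" using \<open>openin _ U\<close> unfolding openin_open by blast
    have "compact (Z - O')" using compact_Z O(1) by (rule compact_diff)
    moreover have "Z - O' \<subseteq> (\<Union>l\<in>C. open_box l)" using C(2) that O by blast
    ultimately obtain D where D: "D \<subseteq> C" "finite D" "Z - O' \<subseteq> (\<Union>l\<in>D. open_box l)"
      using open_open_box by (elim compactE_image) auto
    let ?V = "Z - (\<Union>l\<in>D. closed_box l)"
    have "?V \<in> \<B>" using D by (auto simp: \<B>_def)
    moreover have "x \<in> ?V" using C(3) D(1) x by blast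
    moreover have "?V \<subseteq> U" using D(3) O(2) open_box_subset_closed_box by blast
    ultimately show ?thesis by blast
  qed
  ultimately show "\<exists>\<B>. countable \<B> \<and> (\<forall>V\<in>\<B>. openin (top_of_set Z) V) \<and>
      (\<forall>U. openin (top_of_set Z) U \<and> x \<in> U \<longrightarrow> (\<exists>V\<in>\<B>. x \<in> V \<and> V \<subseteq> U))"
    by blast
qed

section \<open>Fibres of the projections and the weight\<close>

lemma nontrivial_fibres_subset: "nontrivial_fibres Z \<alpha> \<subseteq> L \<alpha>"
proof
  fix x assume "x \<in> nontrivial_fibres Z \<alpha>"
  then obtain y z where "y \<in> Z" "z \<in> Z" "y \<noteq> z" "proj \<alpha> y = x" "proj \<alpha> z = x"
    by (auto simp: nontrivial_fibres_def)
  then show "x \<in> L \<alpha>" using eq_of_proj_eq[of y UNIV z \<alpha>] by auto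
qed

text \<open>Levels are nonempty, so some point is split at every coordinate, and its two values
  extend to points of \<open>Z\<close>.\<close>

lemma ex_proj_eq_neq: "\<exists>y\<in>Z. \<exists>z\<in>Z. y \<noteq> z \<and> proj \<beta> y = proj \<beta> z"
proof -
  obtain x where x: "x \<in> L \<beta>" using level_okD(2)[OF level] by blast
  then have xX: "x \<in> X {..<\<beta>}" using L_subset by blast
  have unc: "uncountable {t. (x, t) \<in> K \<beta>}" using split_okD(5)[OF split] x by blast
  then obtain t where t: "(x, t) \<in> K \<beta>" by (metis countable_empty empty_Collect_eq)
  have "\<not> {t. (x, t) \<in> K \<beta>} \<subseteq> {t}" using unc countable_subset[of _ "{t}"] by auto
  then obtain u where u: "(x, u) \<in> K \<beta>" "u \<noteq> t" by blast
  have ext: "\<exists>y\<in>Z. proj \<beta> y = x \<and> y \<beta> = v" if "(x, v) \<in> K \<beta>" for v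
  proof -
    let ?x = "x(\<beta> := v)"
    have p: "proj \<gamma> ?x = proj \<gamma> x" if "\<gamma> \<le> \<beta>" for \<gamma> using that by (auto simp: proj_eq_iff)
    have "(proj \<gamma> ?x, ?x \<gamma>) \<in> K \<gamma>" if "\<gamma> \<le> \<beta>" for \<gamma>
    proof (cases "\<gamma> = \<beta>")
      case True
      then show ?thesis
        using p[OF order_refl] proj_extensional_eq[OF lim_spaceD(1)[OF xX]] \<open>(x, v) \<in> K \<beta>\<close> by simp
    next
      case False
      then show ?thesis using lim_spaceD(2)[OF xX, of \<gamma>] p[OF that] that by simp
    qed
    moreover have "?x \<in> extensional {..\<beta>}" using lim_spaceD(1)[OF xX] by (auto simp: extensional_def)
    ultimately have "?x \<in> X {..\<beta>}" by (simp add: lim_space_def)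
    then have "\<exists>y\<in>Z. restrict y {..\<beta>} = ?x" by (intro ex_extension) auto
    then obtain y where y: "y \<in> Z" "restrict y {..\<beta>} = ?x" by blast
    have "y \<gamma> = ?x \<gamma>" if "\<gamma> \<le> \<beta>" for \<gamma> using fun_cong[OF y(2), of \<gamma>] that by simp
    then have "proj \<beta> y = proj \<beta> x" "y \<beta> = v" by (auto simp: proj_eq_iff)
    then show ?thesis using y(1) proj_extensional_eq[OF lim_spaceD(1)[OF xX]] by auto
  qed
  show ?thesis using ext[OF t] ext[OF u(1)] u(2) by metis
qed

text \<open>Each base set depends on the coordinates below a countable ordinal. Countably many of
  them depend on those below one \<beta>, and cannot separate two points with the same projection to
  \<beta>.\<close>

lemma uncountable_base:
  assumes "is_base (top_of_set Z) \<B>"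
  shows "uncountable \<B>"
proof
  assume "countable \<B>"
  have "\<exists>\<alpha>. \<forall>x\<in>Z. x \<in> Z - V \<longleftrightarrow> proj \<alpha> x \<in> F \<alpha>" if "V \<in> \<B>" for V
  proof -
    have "openin (top_of_set Z) V" using assms that by (simp add: is_base_def)
    then obtain O' where "open O'" "V = Z \<inter> O'" unfolding openin_open by blast
    moreover from this have "Z - V = Z - O'" by blast
    ultimately have "closed (Z - V)" using closed_Z by (simp add: closed_Diff)
    then show ?thesis using determined[of "Z - V"] by blast
  qed
  then obtain a where a: "\<And>V x. V \<in> \<B> \<Longrightarrow> x \<in> Z \<Longrightarrow> x \<in> Z - V \<longleftrightarrow> proj (a V) x \<in> F (a V)" by metis
  have "countable (a ` \<B>)" using \<open>countable \<B>\<close> by simp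
  then obtain \<beta> where \<beta>: "\<And>V. V \<in> \<B> \<Longrightarrow> a V < \<beta>" 
    using countable_bounded_omega1[OF \<open>countable (a ` \<B>)\<close>] by auto
  obtain y z where yz: "y \<in> Z" "z \<in> Z" "y \<noteq> z" "proj \<beta> y = proj \<beta> z" using ex_proj_eq_neq by blast
  have "closed {z}" by (rule compact_imp_closed_Hausdorff[OF Hausdorff_space_euclidean_fun]) simp
  then have "openin (top_of_set Z) (Z \<inter> - {z})" unfolding openin_open by blast
  moreover have "y \<in> Z \<inter> - {z}" using yz by blast
  ultimately obtain V where V: "V \<in> \<B>" "y \<in> V" "V \<subseteq> Z \<inter> - {z}"
    using assms unfolding is_base_def by meson
  have "proj (a V) y = proj (a V) z"
    using yz(4) \<beta>[OF V(1)] proj_proj[of "a V" \<beta>] by (metis order_less_imp_le)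
  moreover have "proj (a V) y \<notin> F (a V)" using a[OF V(1) yz(1)] V(2) by simp
  moreover have "z \<notin> V" using V(3) by blast
  then have "proj (a V) z \<in> F (a V)" using a[OF V(1) yz(2)] yz(2) by simp
  ultimately show False by simp
qed

lemma aleph1_ordLeq_base:
  assumes "is_base (top_of_set Z) \<B>"
  shows "aleph1 \<le>o |\<B>|"
proof (rule ccontr)
  assume "\<not> ?thesis"
  then have "|\<B>| <o aleph1"
    using not_ordLeq_iff_ordLess[OF card_of_Well_order Well_order_aleph1] by blast
  then have "|\<B>| \<le>o natLeq"
    using cardSuc_ordLeq_ordLess[OF natLeq_Card_order card_of_Card_order] by blast
  then have "|\<B>| \<le>o |UNIV :: nat set|"
    using card_of_nat ordIso_symmetric ordLeq_ordIso_trans by blast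
  then have "countable \<B>"
    unfolding countable_def using card_of_ordLeq[of \<B> "UNIV :: nat set"] by auto
  then show False using uncountable_base[OF assms] by blast
qed

lemma has_weight_Z: "has_weight (top_of_set Z) aleph1"
proof -
  obtain e :: "omega1 \<Rightarrow> (omega1 \<times> rat \<times> rat) list" where "surj e"
    using ex_surj_omega1_lists by blast
  define \<B> where "\<B> = (\<lambda>\<xi>. Z \<inter> open_box (e \<xi>)) ` UNIV"
  have base: "is_base (top_of_set Z) \<B>"
    unfolding is_base_def
  proof (intro conjI ballI allI impI, goal_cases)
    case (1 V)
    then show ?case using open_open_box unfolding \<B>_def openin_open by blast
  next
    case (2 U x)
    then obtain O' where O: "open O'" "U = Z \<inter> O'" unfolding openin_open by blast
    then obtain l where l: "x \<in> open_box l" "closed_box l \<subseteq> O'" using open_contains_box 2 by blast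
    obtain \<xi> where "e \<xi> = l" using \<open>surj e\<close> by (metis surjD)
    then have "Z \<inter> open_box l \<in> \<B>" by (auto simp: \<B>_def)
    then show ?case using l O 2 open_box_subset_closed_box by blast
  qed
  have "|\<B>| \<le>o |UNIV :: omega1 set|" unfolding \<B>_def by (rule card_of_image)
  then have "|\<B>| \<le>o aleph1" using card_of_omega1 ordLeq_ordIso_trans by blast
  then have "|\<B>| =o aleph1" using aleph1_ordLeq_base[OF base] ordIso_iff_ordLeq by blast
  then show ?thesis using base aleph1_ordLeq_base unfolding has_weight_def by blast
qed

lemma Aronszajn_compactum_Z: "Aronszajn_compactum (subtopology cube Z)"
proof -
  have top: "subtopology cube Z = top_of_set Z" using subtopology_cube[OF Z_range] .
  have "closedin cube Z"
    unfolding cube_eq using closed_Z Z_range by (simp add: closed_subset)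
  moreover have "countable (nontrivial_fibres Z \<alpha>)" for \<alpha>
    using nontrivial_fibres_subset level_okD(1)[OF level] countable_subset by blast
  ultimately have "embedded_Aronszajn_compactum Z"
    unfolding embedded_Aronszajn_compactum_def top
    using has_weight_Z first_countable_Z club_UNIV by blast
  moreover have "compact_space (top_of_set Z)" using compact_Z by (simp add: compact_space_subtopology)
  moreover have "Hausdorff_space (top_of_set Z)"
    using Hausdorff_space_subtopology[OF Hausdorff_space_euclidean_fun] .
  moreover have "Z \<subseteq> topspace cube" using Z_range by (simp add: cube_def)
  ultimately show ?thesis
    unfolding Aronszajn_compactum_def
    using has_weight_Z first_countable_Z top homeomorphic_space_refl by metis
qed

end

text \<open>A closed set is encoded by the names of closed boxes missing it, and a guess is decoded
  as the points avoiding the named open boxes. Stationarity supplies a correct guess at an \<alpha>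
  where all boxes on coordinates below \<alpha> have names below \<alpha>.\<close>

lemma ex_determined_tower:
  assumes diamond
  shows "\<exists>K L F. determined_tower K L F"
proof -
  obtain A :: "omega1 \<Rightarrow> omega1 set" where A: "\<And>B. stationary {\<alpha>. B \<inter> {..<\<alpha>} = A \<alpha>}"
    using assms unfolding diamond_def by blast
  obtain e :: "omega1 \<Rightarrow> (omega1 \<times> rat \<times> rat) list" where e: "surj e"
    using ex_surj_omega1_lists by blast
  \<comment> \<open>The test on \<open>lists\<close> discards names of boxes that constrain
    coordinates not yet present at stage \<alpha>.\<close>
  define G where "G K \<alpha> = {x \<in> lim_space K {..<\<alpha>}. \<forall>\<xi>\<in>A \<alpha>. e \<xi> \<in> lists ({..<\<alpha>} \<times> UNIV) \<longrightarrow> x \<notin> open_box (e \<xi>)}"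
    for K \<alpha>
  have "\<exists>K L. tower K L (G K) UNIV"
  proof (rule ex_tower)
    show "G K \<alpha> \<subseteq> lim_space K {..<\<alpha>}" for K \<alpha> by (auto simp: G_def)
    show "G K \<alpha> = G K' \<alpha>" if "\<And>\<beta>. \<beta> < \<alpha> \<Longrightarrow> K \<beta> = K' \<beta>" for K K' \<alpha>
    proof -
      have "lim_space K {..<\<alpha>} = lim_space K' {..<\<alpha>}" by (rule lim_space_cong) (simp add: that)
      then show ?thesis by (simp add: G_def)
    qed
  qed
  then obtain K L where "tower K L (G K) UNIV" by blast
  then interpret tower K L "G K" UNIV .
  have "determined_tower K L (G K)"
  proof unfold_locales
    fix H assume H: "closed H" "H \<subseteq> X UNIV"
    define B where "B = {\<xi>. closed_box (e \<xi>) \<inter> H = {}}"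
    have "{\<alpha>. B \<inter> {..<\<alpha>} = A \<alpha>} \<inter>
        {\<alpha>. (\<exists>\<delta>. \<delta> < \<alpha>) \<and> (\<forall>l\<in>lists ({..<\<alpha>} \<times> UNIV). \<exists>\<xi><\<alpha>. e \<xi> = l)} \<noteq> {}"
      using A[of B, unfolded stationary_def, rule_format, OF club_codes[OF e]] .
    then obtain \<alpha> where "B \<inter> {..<\<alpha>} = A \<alpha> \<and>
        (\<exists>\<delta>. \<delta> < \<alpha>) \<and> (\<forall>l\<in>lists ({..<\<alpha>} \<times> UNIV). \<exists>\<xi><\<alpha>. e \<xi> = l)"
      unfolding ex_in_conv[symmetric] Int_iff mem_Collect_eq by (elim exE) (rule that)
    then have \<alpha>: "B \<inter> {..<\<alpha>} = A \<alpha>" "\<exists>\<gamma>. \<gamma> < \<alpha>"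
        "\<And>l. l \<in> lists ({..<\<alpha>} \<times> UNIV) \<Longrightarrow> \<exists>\<xi><\<alpha>. e \<xi> = l"
      by simp_all
    define C where "C = e ` {\<xi> \<in> A \<alpha>. e \<xi> \<in> lists ({..<\<alpha>} \<times> UNIV)}"
    have "{\<xi> \<in> A \<alpha>. e \<xi> \<in> lists ({..<\<alpha>} \<times> UNIV)} \<subseteq> {..<\<alpha>}" using \<alpha>(1) by blast
    then have "countable C" unfolding C_def using countable_lessThan_omega1 countable_subset by blast
    have C: "l \<in> lists ({..<\<alpha>} \<times> UNIV)" "closed_box l \<inter> H = {}" if "l \<in> C" for l
      using that \<alpha>(1) by (auto simp: C_def B_def)
    have G: "z \<in> G K \<alpha> \<longleftrightarrow> z \<in> X {..<\<alpha>} \<and> (\<forall>l\<in>C. z \<notin> open_box l)" for z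
      by (auto simp: G_def C_def)
    have "compact H" using H compact_lim_space[of UNIV] by (metis compact_Int_closed inf.absorb_iff2 subset_UNIV)
    \<comment> \<open>A point off the compact projection of \<open>H\<close> has a box whose closed
      version misses the projection. Its name below \<alpha> belongs to \<open>B\<close>, hence to
      the guess, so decoding omits the point.\<close>
    have onto: "z \<in> proj \<alpha> ` H" if "z \<in> G K \<alpha>" for z
    proof (rule ccontr)
      assume "z \<notin> proj \<alpha> ` H"
      have zX: "z \<in> X {..<\<alpha>}" using that G by blast
      have "compact (proj \<alpha> ` H)" using continuous_on_proj \<open>compact H\<close> by (rule compact_continuous_image)
      then have "open (- proj \<alpha> ` H)"
        using compact_imp_closed_Hausdorff[OF Hausdorff_space_euclidean_fun] by blast
      moreover have "z \<in> - proj \<alpha> ` H" using \<open>z \<notin> _\<close> by blast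
      ultimately obtain l where l: "l \<in> lists ({..<\<alpha>} \<times> UNIV)" "z \<in> open_box l"
          "closed_box l \<inter> extensional {..<\<alpha>} \<subseteq> - proj \<alpha> ` H"
        using open_contains_box_extensional lim_spaceD(1)[OF zX] by metis
      then obtain \<xi> where \<xi>: "\<xi> < \<alpha>" "e \<xi> = l" using \<alpha>(3) by blast
      have "closed_box l \<inter> H = {}"
        using l(3) proj_in_closed_box_iff[OF l(1)] proj_extensional by blast
      then have "l \<in> C" using \<xi> \<alpha>(1) l(1) by (auto simp: C_def B_def)
      then show False using that G l(2) by blast
    qed
    have iff: "x \<in> H \<longleftrightarrow> proj \<alpha> x \<in> G K \<alpha>" if x: "x \<in> X UNIV" for x
    proof
      assume "x \<in> H"
      have "proj \<alpha> x \<notin> open_box l" if "l \<in> C" for l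
        using C[OF that] \<open>x \<in> H\<close> proj_in_open_box_iff open_box_subset_closed_box by blast
      then show "proj \<alpha> x \<in> G K \<alpha>" using G proj_in_lim_space[OF x] by simp
    next
      assume xG: "proj \<alpha> x \<in> G K \<alpha>"
      show "x \<in> H"
      proof (rule ccontr)
        assume "x \<notin> H"
        \<comment> \<open>Applied to the open set \<open>- H\<close>: all lifts of some
          \<open>z\<close> in the guess would miss \<open>H\<close>, although \<open>z\<close> is
          the projection of a point of \<open>H\<close>.\<close>
        have "\<exists>V. open V \<and> V \<inter> G K \<alpha> \<noteq> {} \<and> (\<forall>y\<in>X UNIV. proj \<alpha> y \<in> V \<longrightarrow> y \<in> - H)"
          by (rule irreducible) (use \<alpha>(2) x xG H(1) \<open>x \<notin> H\<close> in auto)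
        then obtain V z where "z \<in> V" "z \<in> G K \<alpha>" "\<And>y. y \<in> X UNIV \<Longrightarrow> proj \<alpha> y \<in> V \<Longrightarrow> y \<notin> H"
          by blast
        then show False using onto H(2) by blast
      qed
    qed
    have "X UNIV - H \<subseteq> (\<Union>l\<in>C. open_box l)"
    proof
      fix x assume x: "x \<in> X UNIV - H"
      then have "proj \<alpha> x \<notin> G K \<alpha>" using iff by blast
      then obtain l where "l \<in> C" "proj \<alpha> x \<in> open_box l" using G x proj_in_lim_space[of x K UNIV \<alpha>] by auto
      then show "x \<in> (\<Union>l\<in>C. open_box l)" using proj_in_open_box_iff[OF C(1)] by blast
    qed
    moreover have "H \<inter> (\<Union>l\<in>C. closed_box l) = {}" using C(2) by blast
    ultimately show "\<exists>\<alpha> C. (\<exists>\<gamma>. \<gamma> < \<alpha>) \<and> (\<forall>x\<in>X UNIV. x \<in> H \<longleftrightarrow> proj \<alpha> x \<in> G K \<alpha>) \<and> countable C \<and>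
      X UNIV - H \<subseteq> (\<Union>l\<in>C. open_box l) \<and> H \<inter> (\<Union>l\<in>C. closed_box l) = {}"
      using \<alpha>(2) iff \<open>countable C\<close> by (intro exI[of _ \<alpha>] exI[of _ C]) simp
  qed
  then show ?thesis by blast
qed

theorem theorem1p6:
  assumes diamond
  shows "\<exists>X :: (omega1 \<Rightarrow> real) topology.
    Aronszajn_compactum X \<and> hereditarily separable_space X \<and> hereditarily Lindelof_space X"
proof -
  obtain K L F where "determined_tower K L F" using ex_determined_tower[OF assms] by blast
  then interpret determined_tower K L F .
  show ?thesis
    using Aronszajn_compactum_Z hereditarily_separable_Z hereditarily_Lindelof_Z
    by (intro exI[of _ "subtopology cube Z"]) (simp add: subtopology_cube[OF Z_range])
qed

end
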